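(* Let $X$ be a scheme and let $\mathrm{cl}$ be an openly persistent preclosure operation on ideals over $X$. Let $\mathcal{I}\subseteq\mathcal{O}_X$ be a sheaf of ideals (not assumed quasi-coherent). For $U\subseteq X$ open, let $\mathcal{I}^{\mathrm{cl}}(U)$ be the set of all $s\in\mathcal{O}_X(U)$ such that for every $x\in U$ there is an affine open set $V$ with $x\in V\subseteq U$ and $s|_V\in\mathcal{I}(V)^{\mathrm{cl}}$ in $\mathcal{O}_X(V)$. Then: (1) For $U\subseteq X$ open and $s\in\mathcal{O}_X(U)$, we have $s\in\mathcal{I}^{\mathrm{cl}}(U)$ if and only if there is a collection $\{U_\alpha\}_{\alpha\in A}$ of affine open subsets of $U$ with $U=\bigcup_{\alpha\in A}U_\alpha$ such that $s|_{U_\alpha}\in\mathcal{I}(U_\alpha)^{\mathrm{cl}}$ for all $\alpha\in A$. (2) $\mathcal{I}^{\mathrm{cl}}$ is a sheaf of ideals of $\mathcal{O}_X$. (3) The assignment $\mathcal{I}\mapsto\mathcal{I}^{\mathrm{cl}}$ is a preclosure operation on sheaves of ideals: for every ideal sheaf $\mathcal{I}$ we have $\mathcal{I}\subseteq\mathcal{I}^{\mathrm{cl}}$, and for every inclusion of ideal sheaves $\mathcal{J}\subseteq\mathcal{I}$, $\mathcal{J}^{\mathrm{cl}}$ is a subsheaf of $\mathcal{I}^{\mathrm{cl}}$. (4) If moreover $X$ is Noetherian and $\mathrm{cl}$ is a closure operation (i.e. idempotent), then $(\mathcal{I}^{\mathrm{cl}})^{\mathrm{cl}}=\mathcal{I}^{\mathrm{cl}}$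 for every ideal sheaf $\mathcal{I}$.
   Context: All rings are commutative with $1$. A preclosure operation on a poset $(S,\le)$ is a map $s\mapsto s^{\mathrm{cl}}$ that is extensive ($s\le s^{\mathrm{cl}}$) and order-preserving ($s\le t\Rightarrow s^{\mathrm{cl}}\le t^{\mathrm{cl}}$); it is a closure operation if also idempotent. A preclosure (resp. closure) operation $\mathrm{cl}$ on ideals over a scheme $X$ gives, for every affine open $U\subseteq X$, a preclosure (resp. closure) operation $I\mapsto I^{\mathrm{cl}}$ on the poset of ideals of $\mathcal{O}_X(U)$. It is openly persistent on ideals over $X$ if for all affine opens $V\subseteq U\subseteq X$ with restriction map $\varphi:R=\mathcal{O}_X(U)\to S=\mathcal{O}_X(V)$, every ideal $I$ of $R$ and every $x\in I^{\mathrm{cl}}$, we have $\varphi(x)\in(IS)^{\mathrm{cl}}$. *)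

theory Defs
  imports "HOL-Algebra.Ring_Divisibility" "HOL-Analysis.Abstract_Topology"
begin

section \<open>Sheaves and ringed spaces\<close>

text \<open>Only the values of \<open>sections\<close> at open sets and of \<open>restriction\<close> at pairs of open sets
  matter. All rings of sections live in one type \<open>'b\<close>; this is no loss of generality, as the
  types are arbitrary.\<close>

record ('a, 'b) ringed_space =
  underlying :: "'a topology"
  sections :: "'a set \<Rightarrow> 'b ring"
  restriction :: "'a set \<Rightarrow> 'a set \<Rightarrow> 'b \<Rightarrow> 'b"

definition presheaf_of_sets ::
  "'a topology \<Rightarrow> ('a set \<Rightarrow> 'b set) \<Rightarrow> ('a set \<Rightarrow> 'a set \<Rightarrow> 'b \<Rightarrow> 'b) \<Rightarrow> bool" where
  "presheaf_of_sets T F r \<longleftrightarrow>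
     (\<forall>U V. openin T U \<longrightarrow> openin T V \<longrightarrow> V \<subseteq> U \<longrightarrow> (\<forall>s\<in>F U. r U V s \<in> F V)) \<and>
     (\<forall>U. openin T U \<longrightarrow> (\<forall>s\<in>F U. r U U s = s)) \<and>
     (\<forall>U V W. openin T U \<longrightarrow> openin T V \<longrightarrow> openin T W \<longrightarrow> V \<subseteq> U \<longrightarrow> W \<subseteq> V \<longrightarrow>
        (\<forall>s\<in>F U. r V W (r U V s) = r U W s))"

text \<open>Existence and uniqueness of glueing. The empty cover of \<open>{}\<close> is included, so \<open>F {}\<close> has
  exactly one element.\<close>

definition sheaf_of_sets ::
  "'a topology \<Rightarrow> ('a set \<Rightarrow> 'b set) \<Rightarrow> ('a set \<Rightarrow> 'a set \<Rightarrow> 'b \<Rightarrow> 'b) \<Rightarrow> bool" where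
  "sheaf_of_sets T F r \<longleftrightarrow> presheaf_of_sets T F r \<and>
     (\<forall>C t. (\<forall>V\<in>C. openin T V \<and> t V \<in> F V) \<longrightarrow>
        (\<forall>V\<in>C. \<forall>W\<in>C. r V (V \<inter> W) (t V) = r W (V \<inter> W) (t W)) \<longrightarrow>
        (\<exists>!s. s \<in> F (\<Union>C) \<and> (\<forall>V\<in>C. r (\<Union>C) V s = t V)))"

definition is_ringed_space :: "('a, 'b) ringed_space \<Rightarrow> bool" where
  "is_ringed_space X \<longleftrightarrow>
     (\<forall>U. openin (underlying X) U \<longrightarrow> cring (sections X U)) \<and>
     (\<forall>U V. openin (underlying X) U \<longrightarrow> openin (underlying X) V \<longrightarrow> V \<subseteq> U \<longrightarrow>
        restriction X U V \<in> ring_hom (sections X U) (sections X V)) \<and>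
     sheaf_of_sets (underlying X) (\<lambda>U. carrier (sections X U)) (restriction X)"

definition ideal_sheaf :: "('a, 'b) ringed_space \<Rightarrow> ('a set \<Rightarrow> 'b set) \<Rightarrow> bool" where
  "ideal_sheaf X I \<longleftrightarrow>
     (\<forall>U. openin (underlying X) U \<longrightarrow> ideal (I U) (sections X U)) \<and>
     sheaf_of_sets (underlying X) I (restriction X)"

text \<open>A partial order once families agreeing on all open sets are identified.\<close>

definition subsheaf :: "('a, 'b) ringed_space \<Rightarrow> ('a set \<Rightarrow> 'b set) \<Rightarrow> ('a set \<Rightarrow> 'b set) \<Rightarrow> bool" where
  "subsheaf X J I \<longleftrightarrow> (\<forall>U. openin (underlying X) U \<longrightarrow> J U \<subseteq> I U)"

definition open_subspace :: "('a, 'b) ringed_space \<Rightarrow> 'a set \<Rightarrow> ('a, 'b) ringed_space" where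
  "open_subspace X U = X\<lparr>underlying := subtopology (underlying X) U\<rparr>"

section \<open>Stalks and locally ringed spaces\<close>

definition germ_rel :: "('a, 'b) ringed_space \<Rightarrow> 'a \<Rightarrow> (('a set \<times> 'b) \<times> ('a set \<times> 'b)) set" where
  "germ_rel X x = {((U, s), (V, t)).
     openin (underlying X) U \<and> x \<in> U \<and> s \<in> carrier (sections X U) \<and>
     openin (underlying X) V \<and> x \<in> V \<and> t \<in> carrier (sections X V) \<and>
     (\<exists>W. openin (underlying X) W \<and> x \<in> W \<and> W \<subseteq> U \<inter> V \<and>
        restriction X U W s = restriction X V W t)}"

definition germ :: "('a, 'b) ringed_space \<Rightarrow> 'a \<Rightarrow> 'a set \<Rightarrow> 'b \<Rightarrow> ('a set \<times> 'b) set" where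
  "germ X x U s = germ_rel X x `` {(U, s)}"

text \<open>The unions below are over representatives; the united classes all coincide.\<close>

definition stalk :: "('a, 'b) ringed_space \<Rightarrow> 'a \<Rightarrow> ('a set \<times> 'b) set ring" where
  "stalk X x = \<lparr>
     carrier = {germ X x U s | U s.
       openin (underlying X) U \<and> x \<in> U \<and> s \<in> carrier (sections X U)},
     monoid.mult = (\<lambda>A B. \<Union>(U, s)\<in>A. \<Union>(V, t)\<in>B. germ X x (U \<inter> V)
       (restriction X U (U \<inter> V) s \<otimes>\<^bsub>sections X (U \<inter> V)\<^esub> restriction X V (U \<inter> V) t)),
     one = germ X x (topspace (underlying X)) \<one>\<^bsub>sections X (topspace (underlying X))\<^esub>,
     zero = germ X x (topspace (underlying X)) \<zero>\<^bsub>sections X (topspace (underlying X))\<^esub>,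
     add = (\<lambda>A B. \<Union>(U, s)\<in>A. \<Union>(V, t)\<in>B. germ X x (U \<inter> V)
       (restriction X U (U \<inter> V) s \<oplus>\<^bsub>sections X (U \<inter> V)\<^esub> restriction X V (U \<inter> V) t))\<rparr>"

definition local_ring :: "('b, 'm) ring_scheme \<Rightarrow> bool" where
  "local_ring R \<longleftrightarrow> cring R \<and> (\<exists>!m. maximalideal m R)"

definition locally_ringed_space :: "('a, 'b) ringed_space \<Rightarrow> bool" where
  "locally_ringed_space X \<longleftrightarrow>
     is_ringed_space X \<and> (\<forall>x\<in>topspace (underlying X). local_ring (stalk X x))"

text \<open>Isomorphisms of ringed spaces. Between locally ringed spaces these are the same as
  isomorphisms of locally ringed spaces, because the induced isomorphisms of stalks are
  automatically local. The component \<open>h V\<close> maps sections of \<open>Y\<close> over \<open>V\<close> to sections of \<open>X\<close> over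
  the preimage of \<open>V\<close>.\<close>

definition ringed_space_iso :: "('a, 'b) ringed_space \<Rightarrow> ('c, 'd) ringed_space \<Rightarrow>
    ('a \<Rightarrow> 'c) \<Rightarrow> ('c set \<Rightarrow> 'd \<Rightarrow> 'b) \<Rightarrow> bool" where
  "ringed_space_iso X Y f h \<longleftrightarrow>
     homeomorphic_map (underlying X) (underlying Y) f \<and>
     (\<forall>V. openin (underlying Y) V \<longrightarrow>
        h V \<in> ring_iso (sections Y V) (sections X {x \<in> topspace (underlying X). f x \<in> V})) \<and>
     (\<forall>V W. openin (underlying Y) V \<longrightarrow> openin (underlying Y) W \<longrightarrow> W \<subseteq> V \<longrightarrow>
        (\<forall>s\<in>carrier (sections Y V).
           h W (restriction Y V W s) =
           restriction X {x \<in> topspace (underlying X). f x \<in> V}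
             {x \<in> topspace (underlying X). f x \<in> W} (h V s)))"

section \<open>Localization and spectra\<close>

definition frac_rel :: "('b, 'm) ring_scheme \<Rightarrow> 'b set \<Rightarrow> (('b \<times> 'b) \<times> ('b \<times> 'b)) set" where
  "frac_rel R M = {((a, s), (b, t)).
     a \<in> carrier R \<and> s \<in> M \<and> b \<in> carrier R \<and> t \<in> M \<and>
     (\<exists>u\<in>M. u \<otimes>\<^bsub>R\<^esub> (t \<otimes>\<^bsub>R\<^esub> a \<ominus>\<^bsub>R\<^esub> s \<otimes>\<^bsub>R\<^esub> b) = \<zero>\<^bsub>R\<^esub>)}"

definition frac_class :: "('b, 'm) ring_scheme \<Rightarrow> 'b set \<Rightarrow> 'b \<Rightarrow> 'b \<Rightarrow> ('b \<times> 'b) set" where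
  "frac_class R M a s = frac_rel R M `` {(a, s)}"

text \<open>The localization of \<open>R\<close> at a multiplicative subset \<open>M\<close>.\<close>

definition localization :: "('b, 'm) ring_scheme \<Rightarrow> 'b set \<Rightarrow> ('b \<times> 'b) set ring" where
  "localization R M = \<lparr>
     carrier = {frac_class R M a s | a s. a \<in> carrier R \<and> s \<in> M},
     monoid.mult = (\<lambda>A B. \<Union>(a, s)\<in>A. \<Union>(b, t)\<in>B. frac_class R M (a \<otimes>\<^bsub>R\<^esub> b) (s \<otimes>\<^bsub>R\<^esub> t)),
     one = frac_class R M \<one>\<^bsub>R\<^esub> \<one>\<^bsub>R\<^esub>,
     zero = frac_class R M \<zero>\<^bsub>R\<^esub> \<one>\<^bsub>R\<^esub>,
     add = (\<lambda>A B. \<Union>(a, s)\<in>A. \<Union>(b, t)\<in>B.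
       frac_class R M (t \<otimes>\<^bsub>R\<^esub> a \<oplus>\<^bsub>R\<^esub> s \<otimes>\<^bsub>R\<^esub> b) (s \<otimes>\<^bsub>R\<^esub> t))\<rparr>"

definition zariski :: "('b, 'm) ring_scheme \<Rightarrow> 'b set topology" where
  "zariski R = topology (\<lambda>U. \<exists>E\<subseteq>carrier R. U = {p. primeideal p R \<and> \<not> E \<subseteq> p})"

lemma istopology_zariski:
  "istopology (\<lambda>U. \<exists>E\<subseteq>carrier R. U = {p. primeideal p R \<and> \<not> E \<subseteq> p})"
  unfolding istopology_def
proof (intro conjI allI impI)
  fix S T
  assume "\<exists>E\<subseteq>carrier R. S = {p. primeideal p R \<and> \<not> E \<subseteq> p}"
    and "\<exists>E\<subseteq>carrier R. T = {p. primeideal p R \<and> \<not> E \<subseteq> p}"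
  then obtain E F where EF: "E \<subseteq> carrier R" "F \<subseteq> carrier R"
    and S: "S = {p. primeideal p R \<and> \<not> E \<subseteq> p}" and T: "T = {p. primeideal p R \<and> \<not> F \<subseteq> p}"
    by auto
  let ?G = "{a \<otimes>\<^bsub>R\<^esub> b | a b. a \<in> E \<and> b \<in> F} \<inter> carrier R"
  have "\<not> ?G \<subseteq> p \<longleftrightarrow> \<not> E \<subseteq> p \<and> \<not> F \<subseteq> p" if p: "primeideal p R" for p
  proof -
    interpret primeideal p R by (rule p)
    show ?thesis
    proof
      assume "\<not> ?G \<subseteq> p"
      then obtain a b where ab: "a \<in> E" "b \<in> F" "a \<otimes>\<^bsub>R\<^esub> b \<notin> p" by auto
      then have "a \<in> carrier R" "b \<in> carrier R" using EF by auto
      then have "a \<notin> p" "b \<notin> p" using ab(3) I_l_closed[of b a] I_r_closed[of a b] by auto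
      then show "\<not> E \<subseteq> p \<and> \<not> F \<subseteq> p" using ab(1,2) by auto
    next
      assume "\<not> E \<subseteq> p \<and> \<not> F \<subseteq> p"
      then obtain a b where ab: "a \<in> E" "b \<in> F" "a \<notin> p" "b \<notin> p" by auto
      moreover have "a \<in> carrier R" "b \<in> carrier R" using ab EF by auto
      ultimately have "a \<otimes>\<^bsub>R\<^esub> b \<in> ?G" "a \<otimes>\<^bsub>R\<^esub> b \<notin> p" using I_prime by auto
      then show "\<not> ?G \<subseteq> p" by blast
    qed
  qed
  then have "S \<inter> T = {p. primeideal p R \<and> \<not> ?G \<subseteq> p}" unfolding S T by blast
  then show "\<exists>E\<subseteq>carrier R. S \<inter> T = {p. primeideal p R \<and> \<not> E \<subseteq> p}"
    by (intro exI[of _ ?G] conjI) auto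
next
  fix K
  assume K: "\<forall>S\<in>K. \<exists>E\<subseteq>carrier R. S = {p. primeideal p R \<and> \<not> E \<subseteq> p}"
  then have "\<forall>S\<in>K. \<exists>E. E \<subseteq> carrier R \<and> S = {p. primeideal p R \<and> \<not> E \<subseteq> p}" by auto
  then obtain e where e1: "\<And>S. S \<in> K \<Longrightarrow> e S \<subseteq> carrier R"
    and e2: "\<And>S. S \<in> K \<Longrightarrow> S = {p. primeideal p R \<and> \<not> e S \<subseteq> p}"
    by (drule_tac bchoice) blast
  have mem: "p \<in> S \<longleftrightarrow> primeideal p R \<and> \<not> e S \<subseteq> p" if "S \<in> K" for S p
    by (subst e2[OF that]) simp
  have "\<Union>K = {p. primeideal p R \<and> \<not> (\<Union>S\<in>K. e S) \<subseteq> p}"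
    unfolding UN_subset_iff set_eq_iff Union_iff mem_Collect_eq using mem by meson
  moreover have "(\<Union>S\<in>K. e S) \<subseteq> carrier R" using e1 by auto
  ultimately show "\<exists>E\<subseteq>carrier R. \<Union>K = {p. primeideal p R \<and> \<not> E \<subseteq> p}" by (intro exI conjI)
qed

text \<open>Sections of the structure sheaf of \<open>Spec R\<close> over \<open>U\<close> are the functions assigning to each
  \<open>p \<in> U\<close> an element of the localization of \<open>R\<close> at \<open>p\<close> which are locally given by a single
  fraction. They are normalized to \<open>undefined\<close> outside \<open>U\<close> by \<open>PiE\<close>.\<close>

abbreviation localization_at :: "('b, 'm) ring_scheme \<Rightarrow> 'b set \<Rightarrow> ('b \<times> 'b) set ring" where
  "localization_at R p \<equiv> localization R (carrier R - p)"

definition spec_sections ::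
  "('b, 'm) ring_scheme \<Rightarrow> 'b set set \<Rightarrow> ('b set \<Rightarrow> ('b \<times> 'b) set) ring" where
  "spec_sections R U = \<lparr>
     carrier = {s \<in> (\<Pi>\<^sub>E p\<in>U. carrier (localization_at R p)).
       \<forall>p\<in>U. \<exists>V. openin (zariski R) V \<and> p \<in> V \<and> V \<subseteq> U \<and>
         (\<exists>a\<in>carrier R. \<exists>f\<in>carrier R. \<forall>q\<in>V. f \<notin> q \<and> s q = frac_class R (carrier R - q) a f)},
     monoid.mult = (\<lambda>s t. \<lambda>p\<in>U. s p \<otimes>\<^bsub>localization_at R p\<^esub> t p),
     one = (\<lambda>p\<in>U. \<one>\<^bsub>localization_at R p\<^esub>),
     zero = (\<lambda>p\<in>U. \<zero>\<^bsub>localization_at R p\<^esub>),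
     add = (\<lambda>s t. \<lambda>p\<in>U. s p \<oplus>\<^bsub>localization_at R p\<^esub> t p)\<rparr>"

definition Spec :: "('b, 'm) ring_scheme \<Rightarrow> ('b set, 'b set \<Rightarrow> ('b \<times> 'b) set) ringed_space" where
  "Spec R = \<lparr>underlying = zariski R, sections = spec_sections R,
     restriction = (\<lambda>U V s. restrict s V)\<rparr>"

section \<open>Schemes\<close>

text \<open>Taking \<open>R\<close> in the type of the sections of \<open>X\<close> is no restriction, since such an \<open>R\<close> is
  isomorphic to the ring of sections over \<open>U\<close>. If \<open>X\<close> is a locally ringed space then so is its
  restriction to \<open>U\<close>.\<close>

definition affine_open :: "('a, 'b) ringed_space \<Rightarrow> 'a set \<Rightarrow> bool" where
  "affine_open X U \<longleftrightarrow> openin (underlying X) U \<and>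
     (\<exists>(R :: 'b ring) f h. cring R \<and> ringed_space_iso (open_subspace X U) (Spec R) f h)"

definition is_scheme :: "('a, 'b) ringed_space \<Rightarrow> bool" where
  "is_scheme X \<longleftrightarrow> locally_ringed_space X \<and>
     (\<forall>x\<in>topspace (underlying X). \<exists>U. affine_open X U \<and> x \<in> U)"

definition noetherian_scheme :: "('a, 'b) ringed_space \<Rightarrow> bool" where
  "noetherian_scheme X \<longleftrightarrow> is_scheme X \<and>
     (\<exists>C. finite C \<and> (\<forall>U\<in>C. affine_open X U \<and> noetherian_ring (sections X U)) \<and>
        \<Union>C = topspace (underlying X))"

section \<open>Preclosure operations\<close>

definition preclosure_on :: "'s set \<Rightarrow> ('s \<Rightarrow> 's \<Rightarrow> bool) \<Rightarrow> ('s \<Rightarrow> 's) \<Rightarrow> bool" where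
  "preclosure_on S leq c \<longleftrightarrow>
     (\<forall>s\<in>S. c s \<in> S) \<and> (\<forall>s\<in>S. leq s (c s)) \<and> (\<forall>s\<in>S. \<forall>t\<in>S. leq s t \<longrightarrow> leq (c s) (c t))"

definition closure_on :: "'s set \<Rightarrow> ('s \<Rightarrow> 's \<Rightarrow> bool) \<Rightarrow> ('s \<Rightarrow> 's) \<Rightarrow> bool" where
  "closure_on S leq c \<longleftrightarrow> preclosure_on S leq c \<and> (\<forall>s\<in>S. c (c s) = c s)"

text \<open>In the following, \<open>cl U I\<close> is the (pre)closure of the ideal \<open>I\<close> of the ring of sections over
  \<open>U\<close>; only affine open \<open>U\<close> are relevant.\<close>

definition ideals_preclosure ::
  "('a, 'b) ringed_space \<Rightarrow> ('a set \<Rightarrow> 'b set \<Rightarrow> 'b set) \<Rightarrow> bool" where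
  "ideals_preclosure X cl \<longleftrightarrow>
     (\<forall>U. affine_open X U \<longrightarrow> preclosure_on {I. ideal I (sections X U)} (\<subseteq>) (cl U))"

definition ideals_closure ::
  "('a, 'b) ringed_space \<Rightarrow> ('a set \<Rightarrow> 'b set \<Rightarrow> 'b set) \<Rightarrow> bool" where
  "ideals_closure X cl \<longleftrightarrow>
     (\<forall>U. affine_open X U \<longrightarrow> closure_on {I. ideal I (sections X U)} (\<subseteq>) (cl U))"

definition openly_persistent ::
  "('a, 'b) ringed_space \<Rightarrow> ('a set \<Rightarrow> 'b set \<Rightarrow> 'b set) \<Rightarrow> bool" where
  "openly_persistent X cl \<longleftrightarrow>
     (\<forall>U V. affine_open X U \<longrightarrow> affine_open X V \<longrightarrow> V \<subseteq> U \<longrightarrow>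
        (\<forall>I. ideal I (sections X U) \<longrightarrow>
           (\<forall>x\<in>cl U I. restriction X U V x \<in>
              cl V (genideal (sections X V) (restriction X U V ` I)))))"

definition sheaf_cl ::
  "('a, 'b) ringed_space \<Rightarrow> ('a set \<Rightarrow> 'b set \<Rightarrow> 'b set) \<Rightarrow> ('a set \<Rightarrow> 'b set) \<Rightarrow> 'a set \<Rightarrow> 'b set" where
  "sheaf_cl X cl I U = {s \<in> carrier (sections X U).
     \<forall>x\<in>U. \<exists>V. affine_open X V \<and> x \<in> V \<and> V \<subseteq> U \<and> restriction X U V s \<in> cl V (I V)}"

end

theory Submission
  imports Defs
begin

text \<open>
  The closure of an ideal sheaf is defined by a condition that is local by construction, so the
  description by covers is immediate and glueing is inherited from the structure sheaf. All remaining
  claims need one fact about the condition: if it holds for a section on an affine set, it holds on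
  every smaller affine set. This is open persistence together with monotonicity of the preclosure
  (\<open>res_cl\<close>, \<open>cl_shrink\<close>). Two sections satisfying the condition on different affine neighbourhoods of a
  point can then be compared, provided that the intersection of the neighbourhoods contains an affine
  neighbourhood. So the substance of the proof that the closure is a sheaf of ideals is that affine
  open sets form a basis (\<open>affine_neighbourhood\<close>).

  For this it must be shown that a basic open subset \<open>D(g)\<close> of \<open>Spec R\<close> is again the spectrum of a
  ring. The ring is the one of sections over \<open>D(g)\<close>. It is the localization of \<open>R\<close> at the powers of
  \<open>g\<close> (\<open>section_on_basic_open\<close>), and if the primes that survive in a localization of \<open>R\<close> form an open
  set, its spectrum is that open subspace of \<open>Spec R\<close> (\<open>Spec_iso\<close>). All passages from stalks to rings rest on the
  existence of primes avoiding a multiplicative set, in the form of \<open>power_mem_ideal\<close>.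

  Idempotence needs infinitely many conditions on a single neighbourhood, one for every element of the
  ideal of sections over an affine set. On a Noetherian scheme finitely many generators suffice
  (\<open>common_affine_neighbourhood\<close>), since the affine sets whose rings are Noetherian form a basis
  (\<open>noetherian_affine_neighbourhood\<close>): a localization of a Noetherian ring is Noetherian.
\<close>

section \<open>Prime ideals avoiding a multiplicative set\<close>

lemma (in cring) ideal_closedI:
  assumes "I \<subseteq> carrier R" "\<zero> \<in> I"
    and add: "\<And>a b. a \<in> I \<Longrightarrow> b \<in> I \<Longrightarrow> a \<oplus> b \<in> I"
    and mult: "\<And>a x. a \<in> I \<Longrightarrow> x \<in> carrier R \<Longrightarrow> x \<otimes> a \<in> I"
  shows "ideal I R"
proof (rule idealI[OF ring_axioms])
  have neg: "\<ominus> a \<in> I" if "a \<in> I" for a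
  proof -
    have "a \<in> carrier R" using that assms(1) by auto
    then have "\<ominus> a = (\<ominus> \<one>) \<otimes> a" by (simp add: l_minus)
    then show ?thesis using mult[OF that, of "\<ominus> \<one>"] by simp
  qed
  show "subgroup I (add_monoid R)"
    using assms neg by (intro add.subgroupI) (auto simp: a_inv_def)
  show "\<And>a x. a \<in> I \<Longrightarrow> x \<in> carrier R \<Longrightarrow> x \<otimes> a \<in> I" by (rule mult)
  show "\<And>a x. a \<in> I \<Longrightarrow> x \<in> carrier R \<Longrightarrow> a \<otimes> x \<in> I"
    using mult assms(1) by (simp add: m_comm subset_iff)
qed

lemma (in cring) colon_ideal:
  assumes "ideal J R" "a \<in> carrier R"
  shows "ideal {x \<in> carrier R. x \<otimes> a \<in> J} R"
proof -
  interpret J: ideal J R by fact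
  show ?thesis
    using assms(2) by (intro ideal_closedI)
      (auto simp: l_distr m_assoc J.I_l_closed J.zero_closed)
qed

text \<open>An ideal that is maximal among those disjoint from \<open>M\<close> is prime: if \<open>a b\<close> lies in
  \<open>J\<close> but \<open>a\<close> and \<open>b\<close> do not, then the colon ideal \<open>(J : a)\<close> is larger than \<open>J\<close>, so it contains some
  \<open>m \<in> M\<close>; then \<open>(J : m)\<close> contains \<open>a\<close>, so it contains some \<open>m' \<in> M\<close>, and \<open>m' m \<in> J\<close>. Working with
  colon ideals avoids sums of ideals.\<close>

lemma (in cring) exists_prime_avoiding:
  assumes I: "ideal I R" and M1: "\<one> \<in> M"
    and Mm: "\<And>a b. a \<in> M \<Longrightarrow> b \<in> M \<Longrightarrow> a \<otimes> b \<in> M" and disj: "I \<inter> M = {}" and MR: "M \<subseteq> carrier R"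
  obtains p where "primeideal p R" "I \<subseteq> p" "p \<inter> M = {}"
proof -
  let ?S = "{J. ideal J R \<and> I \<subseteq> J \<and> J \<inter> M = {}}"
  have "\<exists>J\<in>?S. \<forall>K\<in>?S. J \<subseteq> K \<longrightarrow> K = J"
  proof (rule subset_Zorn_nonempty)
    show "?S \<noteq> {}" using I disj by auto
    fix C assume C: "C \<noteq> {}" "subset.chain ?S C"
    then have ch: "subset.chain {J. ideal J R} C" and CS: "C \<subseteq> ?S"
      unfolding pred_on.chain_def by auto
    have "ideal (\<Union>C) R" using chain_Union_is_ideal[OF ch] C(1) by simp
    then show "\<Union>C \<in> ?S" using CS C(1) by blast
  qed
  then obtain J where JS: "J \<in> ?S" and mx': "\<forall>K\<in>?S. J \<subseteq> K \<longrightarrow> K = J" by (rule bexE)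
  have J: "ideal J R" "I \<subseteq> J" "J \<inter> M = {}" using JS by auto
  have mx: "K = J" if "ideal K R" "J \<subseteq> K" "K \<inter> M = {}" for K
    using mx'[rule_format, of K] that J(2) by simp
  interpret J: ideal J R by fact
  have meet: "\<exists>m\<in>M. m \<otimes> a \<in> J" if a: "a \<in> carrier R" and b: "b \<in> carrier R" "b \<otimes> a \<in> J" "b \<notin> J" for a b
  proof (rule ccontr)
    assume n: "\<not> ?thesis"
    have "{x \<in> carrier R. x \<otimes> a \<in> J} = J"
      using n a by (intro mx colon_ideal J) (auto simp: J.I_r_closed)
    then show False using b by blast
  qed
  have "primeideal J R"
  proof (rule primeidealI[OF J(1) is_cring])
    show "carrier R \<noteq> J" using M1 J(3) by auto
    fix a b assume ab: "a \<in> carrier R" "b \<in> carrier R" "a \<otimes> b \<in> J"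
    show "a \<in> J \<or> b \<in> J"
    proof (rule ccontr)
      assume n: "\<not> ?thesis"
      then obtain m where m: "m \<in> M" "m \<otimes> a \<in> J" using meet[of a b] ab by (auto simp: m_comm)
      then obtain m' where "m' \<in> M" "m' \<otimes> m \<in> J"
        using meet[of m a] ab n MR by (metis m_comm subsetD)
      then show False using Mm[OF _ m(1)] J(3) by blast
    qed
  qed
  then show thesis using J that by blast
qed

lemma (in primeideal) pow_mem_imp_mem:
  assumes "g \<in> carrier R" "g [^] (n::nat) \<in> I"
  shows "g \<in> I"
  using assms(2)
proof (induction n)
  case 0
  then have "I = carrier R" using one_imp_carrier by simp
  then show ?case using I_notcarr by simp
next
  case (Suc n)
  then show ?case using I_prime[of "g [^] n" g] assms(1) by auto
qed

text \<open>The bridge from local to global: an ideal of elements with some desired property, if it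
  is contained in no prime of \<open>D(g)\<close>, contains a power of \<open>g\<close>, because the powers of \<open>g\<close> are a
  multiplicative set. It is used below with annihilators and with ideals of denominators.\<close>

lemma (in cring) power_mem_ideal:
  assumes "ideal I R" "g \<in> carrier R"
    and loc: "\<And>p. primeideal p R \<Longrightarrow> g \<notin> p \<Longrightarrow> \<not> I \<subseteq> p"
  shows "\<exists>n::nat. g [^] n \<in> I"
proof (rule ccontr)
  assume n: "\<not> ?thesis"
  obtain p where "primeideal p R" "I \<subseteq> p" "p \<inter> range (\<lambda>n::nat. g [^] n) = {}"
  proof (rule exists_prime_avoiding[OF assms(1), of "range (\<lambda>n::nat. g [^] n)"])
    show "\<one> \<in> range (\<lambda>n::nat. g [^] n)" by (rule range_eqI[of _ _ 0]) simp
    show "a \<otimes> b \<in> range (\<lambda>n::nat. g [^] n)" 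
      if "a \<in> range (\<lambda>n::nat. g [^] n)" "b \<in> range (\<lambda>n::nat. g [^] n)" for a b
      using that assms(2) by (auto simp: nat_pow_mult)
  qed (use n assms(2) in auto)
  moreover have "g \<in> range (\<lambda>n::nat. g [^] n)"
    using assms(2) by (intro range_eqI[of _ _ 1]) simp
  ultimately show False using loc by blast
qed

text \<open>The algebraic form of the quasi-compactness of basic open sets.\<close>

lemma (in cring) finite_subset_genideal:
  assumes "K \<subseteq> carrier R" "x \<in> genideal R K"
  obtains F where "finite F" "F \<subseteq> K" "x \<in> genideal R F"
proof -
  let ?J = "\<Union>F\<in>{F. finite F \<and> F \<subseteq> K}. genideal R F"
  have id: "ideal (genideal R F) R" if "F \<subseteq> K" for F
    using genideal_ideal[of F] that assms(1) by auto
  have mono: "genideal R F \<subseteq> genideal R G" if "F \<subseteq> G" for F G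
    using that unfolding genideal_def by blast
  have "ideal ?J R"
  proof (rule ideal_closedI)
    show "?J \<subseteq> carrier R" using ideal.Icarr[OF id] by auto
    have "\<zero> \<in> genideal R {}" using id[of "{}"] 
      by (simp add: additive_subgroup.zero_closed ideal.axioms(1))
    then show "\<zero> \<in> ?J" by (intro UN_I[of "{}"]) auto
    show "a \<oplus> b \<in> ?J" if ab: "a \<in> ?J" "b \<in> ?J" for a b
    proof -
      obtain F G where FG: "finite F" "F \<subseteq> K" "a \<in> genideal R F"
        "finite G" "G \<subseteq> K" "b \<in> genideal R G" using ab by auto
      then have "a \<in> genideal R (F \<union> G)" "b \<in> genideal R (F \<union> G)" using mono by blast+
      then have "a \<oplus> b \<in> genideal R (F \<union> G)" using id[of "F \<union> G"] FG
        by (simp add: additive_subgroup.a_closed ideal.axioms(1))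
      then show ?thesis using FG by blast
    qed
    show "r \<otimes> a \<in> ?J" if "a \<in> ?J" "r \<in> carrier R" for a r
      using that ideal.I_l_closed[OF id] by auto
  qed
  moreover have "K \<subseteq> ?J"
  proof
    fix k assume "k \<in> K"
    then show "k \<in> ?J" using genideal_self[of "{k}"] assms(1) by (intro UN_I[of "{k}"]) auto
  qed
  ultimately have "genideal R K \<subseteq> ?J" using genideal_minimal by blast
  then show thesis using assms(2) that by blast
qed

section \<open>Fractions\<close>

lemma (in cring) diff_zero_iff:
  assumes "u \<in> carrier R" "x \<in> carrier R" "y \<in> carrier R"
  shows "u \<otimes> (x \<ominus> y) = \<zero> \<longleftrightarrow> u \<otimes> x = u \<otimes> y"
proof -
  have "u \<otimes> (x \<ominus> y) = u \<otimes> x \<ominus> u \<otimes> y" using assms by (simp add: minus_eq r_distr r_minus)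
  then show ?thesis using assms by simp
qed

locale fractions = cring R for R :: "('b, 'm) ring_scheme" (structure) and M +
  assumes M_sub: "M \<subseteq> carrier R" and M_one: "\<one> \<in> M"
    and M_mult: "\<And>a b. a \<in> M \<Longrightarrow> b \<in> M \<Longrightarrow> a \<otimes> b \<in> M"
begin

lemma M_carr: "m \<in> M \<Longrightarrow> m \<in> carrier R"
  using M_sub by blast

declare M_one [simp] M_mult [simp]

lemma frac_rel_iff:
  "((a, s), (b, t)) \<in> frac_rel R M \<longleftrightarrow> a \<in> carrier R \<and> s \<in> M \<and> b \<in> carrier R \<and> t \<in> M \<and>
     (\<exists>u\<in>M. u \<otimes> (t \<otimes> a) = u \<otimes> (s \<otimes> b))"
  unfolding frac_rel_def by (auto simp: M_carr diff_zero_iff)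

lemma equiv_frac_rel: "equiv (carrier R \<times> M) (frac_rel R M)"
proof (rule equivI)
  show "frac_rel R M \<subseteq> (carrier R \<times> M) \<times> (carrier R \<times> M)" by (auto simp: M_carr frac_rel_iff)
  show "refl_on (carrier R \<times> M) (frac_rel R M)"
    by (auto simp: M_carr refl_on_def frac_rel_iff intro: M_one)
  show "sym (frac_rel R M)" by (rule symI) (auto simp: M_carr frac_rel_iff, metis)
  show "trans (frac_rel R M)"
  proof (rule transI, clarify)
    fix a s b t c w
    assume "((a, s), (b, t)) \<in> frac_rel R M" "((b, t), (c, w)) \<in> frac_rel R M"
    then obtain u v where m: "a \<in> carrier R" "s \<in> M" "b \<in> carrier R" "t \<in> M" "c \<in> carrier R" "w \<in> M"
      "u \<in> M" "v \<in> M" and e: "u \<otimes> (t \<otimes> a) = u \<otimes> (s \<otimes> b)" "v \<otimes> (w \<otimes> b) = v \<otimes> (t \<otimes> c)"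
      by (auto simp: M_carr frac_rel_iff)
    have "(u \<otimes> v \<otimes> t) \<otimes> (w \<otimes> a) = (v \<otimes> w) \<otimes> (u \<otimes> (t \<otimes> a))" using m by (simp add: M_carr m_ac)
    also have "\<dots> = (u \<otimes> s) \<otimes> (v \<otimes> (w \<otimes> b))" unfolding e(1) using m by (simp add: M_carr m_ac)
    also have "\<dots> = (u \<otimes> v \<otimes> t) \<otimes> (s \<otimes> c)" unfolding e(2) using m by (simp add: M_carr m_ac)
    finally show "((a, s), (c, w)) \<in> frac_rel R M" using m by (auto simp: M_carr frac_rel_iff)
  qed
qed

abbreviation cls where "cls \<equiv> frac_class R M"

lemma cls_eq_iff:
  assumes "a \<in> carrier R" "s \<in> M" "b \<in> carrier R" "t \<in> M"
  shows "cls a s = cls b t \<longleftrightarrow> (\<exists>u\<in>M. u \<otimes> (t \<otimes> a) = u \<otimes> (s \<otimes> b))"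
  unfolding frac_class_def
  using eq_equiv_class_iff[OF equiv_frac_rel, of "(a, s)" "(b, t)"] assms by (simp add: M_carr frac_rel_iff)

lemma cls_eqI:
  assumes "a \<in> carrier R" "s \<in> M" "b \<in> carrier R" "t \<in> M" "t \<otimes> a = s \<otimes> b"
  shows "cls a s = cls b t"
  using cls_eq_iff[OF assms(1-4)] assms(5) M_one by metis

lemma mem_cls_iff:
  assumes "a \<in> carrier R" "s \<in> M"
  shows "(b, t) \<in> cls a s \<longleftrightarrow> b \<in> carrier R \<and> t \<in> M \<and> cls b t = cls a s"
proof -
  have "(b, t) \<in> cls a s \<longleftrightarrow> ((a, s), (b, t)) \<in> frac_rel R M" by (simp add: M_carr frac_class_def)
  then show ?thesis using assms cls_eq_iff[of a s b t] frac_rel_iff[of a s b t] by auto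
qed

lemma carrier_localizationE:
  assumes "A \<in> carrier (localization R M)"
  obtains a s where "a \<in> carrier R" "s \<in> M" "A = cls a s"
  using assms by (auto simp: M_carr localization_def)

lemma cls_closed [simp]:
  "a \<in> carrier R \<Longrightarrow> s \<in> M \<Longrightarrow> cls a s \<in> carrier (localization R M)"
  by (auto simp: M_carr localization_def)

lemma UN_representatives_const:
  assumes "a \<in> carrier R" "s \<in> M" "b \<in> carrier R" "t \<in> M"
    and "\<And>a' s' b' t'. a' \<in> carrier R \<Longrightarrow> s' \<in> M \<Longrightarrow> b' \<in> carrier R \<Longrightarrow> t' \<in> M \<Longrightarrow>
       cls a' s' = cls a s \<Longrightarrow> cls b' t' = cls b t \<Longrightarrow> f a' s' b' t' = c"
  shows "(\<Union>(a', s')\<in>cls a s. \<Union>(b', t')\<in>cls b t. f a' s' b' t') = c"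
proof -
  have "(a, s) \<in> cls a s" "(b, t) \<in> cls b t" using assms(1-4) by (auto simp: M_carr mem_cls_iff)
  moreover have "f a' s' b' t' = c" if "(a', s') \<in> cls a s" "(b', t') \<in> cls b t" for a' s' b' t'
    using that assms by (auto simp: M_carr mem_cls_iff)
  ultimately show ?thesis by fastforce
qed

lemma mult_cls:
  assumes "a \<in> carrier R" "s \<in> M" "b \<in> carrier R" "t \<in> M"
  shows "cls a s \<otimes>\<^bsub>localization R M\<^esub> cls b t = cls (a \<otimes> b) (s \<otimes> t)"
proof -
  have "cls (a' \<otimes> b') (s' \<otimes> t') = cls (a \<otimes> b) (s \<otimes> t)"
    if m: "a' \<in> carrier R" "s' \<in> M" "b' \<in> carrier R" "t' \<in> M"
      and e: "cls a' s' = cls a s" "cls b' t' = cls b t" for a' s' b' t'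
  proof -
    obtain u v where uv: "u \<in> M" "v \<in> M" "u \<otimes> (s \<otimes> a') = u \<otimes> (s' \<otimes> a)"
      "v \<otimes> (t \<otimes> b') = v \<otimes> (t' \<otimes> b)" using e m assms by (auto simp: M_carr cls_eq_iff)
    have "(u \<otimes> v) \<otimes> ((s \<otimes> t) \<otimes> (a' \<otimes> b')) = (u \<otimes> (s \<otimes> a')) \<otimes> (v \<otimes> (t \<otimes> b'))"
      using m assms uv(1,2) by (simp add: M_carr m_ac)
    also have "\<dots> = (u \<otimes> v) \<otimes> ((s' \<otimes> t') \<otimes> (a \<otimes> b))"
      unfolding uv(3,4) using m assms uv(1,2) by (simp add: M_carr m_ac)
    finally show ?thesis using m assms uv(1,2) by (subst cls_eq_iff) (auto simp: M_carr intro!: bexI[of _ "u \<otimes> v"])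
  qed
  then show ?thesis by (simp add: M_carr localization_def UN_representatives_const[OF assms])
qed

lemma add_cls:
  assumes "a \<in> carrier R" "s \<in> M" "b \<in> carrier R" "t \<in> M"
  shows "cls a s \<oplus>\<^bsub>localization R M\<^esub> cls b t = cls (t \<otimes> a \<oplus> s \<otimes> b) (s \<otimes> t)"
proof -
  have "cls (t' \<otimes> a' \<oplus> s' \<otimes> b') (s' \<otimes> t') = cls (t \<otimes> a \<oplus> s \<otimes> b) (s \<otimes> t)"
    if m: "a' \<in> carrier R" "s' \<in> M" "b' \<in> carrier R" "t' \<in> M"
      and e: "cls a' s' = cls a s" "cls b' t' = cls b t" for a' s' b' t'
  proof -
    obtain u v where uv: "u \<in> M" "v \<in> M" "u \<otimes> (s \<otimes> a') = u \<otimes> (s' \<otimes> a)"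
      "v \<otimes> (t \<otimes> b') = v \<otimes> (t' \<otimes> b)" using e m assms by (auto simp: M_carr cls_eq_iff)
    have "(u \<otimes> v) \<otimes> ((s \<otimes> t) \<otimes> (t' \<otimes> a' \<oplus> s' \<otimes> b')) =
        (v \<otimes> t \<otimes> t') \<otimes> (u \<otimes> (s \<otimes> a')) \<oplus> (u \<otimes> s \<otimes> s') \<otimes> (v \<otimes> (t \<otimes> b'))"
      using m assms uv(1,2) by (simp add: M_carr m_ac r_distr)
    also have "\<dots> = (u \<otimes> v) \<otimes> ((s' \<otimes> t') \<otimes> (t \<otimes> a \<oplus> s \<otimes> b))"
      unfolding uv(3,4) using m assms uv(1,2) by (simp add: M_carr m_ac r_distr)
    finally show ?thesis using m assms uv(1,2) by (subst cls_eq_iff) (auto simp: M_carr intro!: bexI[of _ "u \<otimes> v"])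
  qed
  then show ?thesis by (simp add: M_carr localization_def UN_representatives_const[OF assms])
qed

lemma one_cls: "\<one>\<^bsub>localization R M\<^esub> = cls \<one> \<one>"
  by (simp add: localization_def)

end

lemma fractions_prime:
  fixes R (structure)
  assumes "primeideal p R"
  shows "fractions R (carrier R - p)"
proof -
  interpret primeideal p R by fact
  show ?thesis
  proof
    show "\<one> \<in> carrier R - p" using one_imp_carrier I_notcarr by auto
    show "a \<otimes> b \<in> carrier R - p" if "a \<in> carrier R - p" "b \<in> carrier R - p" for a b
      using that I_prime[of a b] by auto
  qed auto
qed

section \<open>Spectra and their basic open sets\<close>

definition basic_open :: "('b, 'm) ring_scheme \<Rightarrow> 'b \<Rightarrow> 'b set set" where
  "basic_open R g = {p. primeideal p R \<and> g \<notin> p}"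

abbreviation frac_at :: "('b, 'm) ring_scheme \<Rightarrow> 'b set \<Rightarrow> 'b \<Rightarrow> 'b \<Rightarrow> ('b \<times> 'b) set" where
  "frac_at R p \<equiv> frac_class R (carrier R - p)"

lemma openin_zariski:
  "openin (zariski R) U \<longleftrightarrow> (\<exists>E\<subseteq>carrier R. U = {p. primeideal p R \<and> \<not> E \<subseteq> p})"
  unfolding zariski_def by (subst topology_inverse'[OF istopology_zariski]) (rule refl)

lemma openin_basic_open: "g \<in> carrier R \<Longrightarrow> openin (zariski R) (basic_open R g)"
  unfolding openin_zariski basic_open_def by (rule exI[of _ "{g}"]) auto

lemma openin_zariski_prime: "openin (zariski R) U \<Longrightarrow> p \<in> U \<Longrightarrow> primeideal p R"
  unfolding openin_zariski by blast

lemma topspace_zariski: "topspace (zariski R) = {p. primeideal p R}"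
proof
  show "topspace (zariski R) \<subseteq> {p. primeideal p R}"
    using openin_zariski_prime[OF openin_topspace] by auto
  have "{p. primeideal p R} = {p. primeideal p R \<and> \<not> carrier R \<subseteq> p}"
  proof (intro Collect_cong iffI conjI)
    fix p assume "primeideal p R"
    then show "\<not> carrier R \<subseteq> p"
      using primeideal.I_notcarr additive_subgroup.a_subset[OF ideal.axioms(1)[OF primeideal.axioms(1)]]
      by (metis subset_antisym)
  qed auto
  then have "openin (zariski R) {p. primeideal p R}" unfolding openin_zariski by blast
  then show "{p. primeideal p R} \<subseteq> topspace (zariski R)" by (rule openin_subset)
qed

lemma zariski_basis:
  assumes "openin (zariski R) U" "p \<in> U"
  obtains g where "g \<in> carrier R" "p \<in> basic_open R g" "basic_open R g \<subseteq> U"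
proof -
  obtain E where E: "E \<subseteq> carrier R" "U = {p. primeideal p R \<and> \<not> E \<subseteq> p}"
    using assms(1) unfolding openin_zariski by blast
  then obtain g where "g \<in> E" "g \<notin> p" "primeideal p R" using assms(2) by blast
  then show thesis using E by (intro that[of g]) (auto simp: basic_open_def)
qed

lemma const_section:
  assumes "openin (zariski R) U" "a \<in> carrier R" "f \<in> carrier R" "\<And>q. q \<in> U \<Longrightarrow> f \<notin> q"
  shows "(\<lambda>q\<in>U. frac_at R q a f) \<in> carrier (spec_sections R U)"
proof -
  have "frac_at R q a f \<in> carrier (localization_at R q)" if "q \<in> U" for q
    using that assms by (auto simp: localization_def)
  moreover have "\<exists>V. openin (zariski R) V \<and> p \<in> V \<and> V \<subseteq> U \<and>
         (\<exists>a'\<in>carrier R. \<exists>f'\<in>carrier R. \<forall>q\<in>V. f' \<notin> q \<and>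
            (\<lambda>q\<in>U. frac_at R q a f) q = frac_at R q a' f')" if "p \<in> U" for p
    using that assms by (intro exI[of _ U] conjI bexI[of _ a] bexI[of _ f]) auto
  ultimately show ?thesis unfolding spec_sections_def by simp
qed

lemma (in fractions) mult_eq_const_iff:
  assumes "d \<in> carrier R" "x \<in> carrier R" "y \<in> M" "b \<in> carrier R"
  shows "cls d \<one> \<otimes>\<^bsub>localization R M\<^esub> cls x y = cls b \<one> \<longleftrightarrow> (\<exists>u\<in>M. u \<otimes> (d \<otimes> x) = u \<otimes> (y \<otimes> b))"
  using assms by (simp add: M_carr mult_cls cls_eq_iff)

text \<open>The elements \<open>d\<close> for which \<open>d s\<close> comes from a ring element on all of \<open>U\<close>. This ideal turns
  the search for a global denominator of \<open>s\<close> into a question about single primes. A representative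
  of every value \<open>s q\<close> is chosen once, so that sums need only one common representative.\<close>

lemma (in cring) denominators_ideal:
  assumes prime: "\<And>q. q \<in> U \<Longrightarrow> primeideal q R"
    and s: "\<And>q. q \<in> U \<Longrightarrow> s q \<in> carrier (localization_at R q)"
  shows "ideal {d \<in> carrier R. \<exists>b\<in>carrier R. \<forall>q\<in>U.
    frac_at R q d \<one> \<otimes>\<^bsub>localization_at R q\<^esub> s q = frac_at R q b \<one>} R" (is "ideal ?I R")
proof -
  have "\<forall>q\<in>U. \<exists>x y. x \<in> carrier R \<and> y \<in> carrier R - q \<and> s q = frac_at R q x y"
    using fractions.carrier_localizationE[OF fractions_prime[OF prime] s] by metis
  then obtain x y where xy: "\<And>q. q \<in> U \<Longrightarrow> x q \<in> carrier R" "\<And>q. q \<in> U \<Longrightarrow> y q \<in> carrier R - q"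
    "\<And>q. q \<in> U \<Longrightarrow> s q = frac_at R q (x q) (y q)" by metis
  have yc: "y q \<in> carrier R" if "q \<in> U" for q using xy(2)[OF that] by simp
  have eq: "frac_at R q d \<one> \<otimes>\<^bsub>localization_at R q\<^esub> s q = frac_at R q b \<one> \<longleftrightarrow>
      (\<exists>u\<in>carrier R - q. u \<otimes> (d \<otimes> x q) = u \<otimes> (y q \<otimes> b))"
    if "q \<in> U" "d \<in> carrier R" "b \<in> carrier R" for q d b
    using fractions.mult_eq_const_iff[OF fractions_prime[OF prime]] xy that by metis
  have I: "d \<in> ?I \<longleftrightarrow> d \<in> carrier R \<and> (\<exists>b\<in>carrier R. \<forall>q\<in>U. \<exists>u\<in>carrier R - q.
      u \<otimes> (d \<otimes> x q) = u \<otimes> (y q \<otimes> b))" for d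
    using eq by (simp cong: conj_cong bex_cong ball_cong)
  show ?thesis
  proof (rule ideal_closedI)
    show "\<zero> \<in> ?I" unfolding I
    proof (intro conjI bexI[of _ "\<zero>" "carrier R"] ballI)
      fix q assume q: "q \<in> U"
      interpret fractions R "carrier R - q" using fractions_prime[OF prime[OF q]] .
      show "\<exists>u\<in>carrier R - q. u \<otimes> (\<zero> \<otimes> x q) = u \<otimes> (y q \<otimes> \<zero>)"
        using xy(1)[OF q] yc[OF q] by (intro bexI[of _ \<one>]) (simp, simp only: M_one)
    qed auto
    show "d \<oplus> e \<in> ?I" if "d \<in> ?I" "e \<in> ?I" for d e
    proof -
      from that obtain b c where bc: "d \<in> carrier R" "e \<in> carrier R" "b \<in> carrier R" "c \<in> carrier R"
        "\<And>q. q \<in> U \<Longrightarrow> \<exists>u\<in>carrier R - q. u \<otimes> (d \<otimes> x q) = u \<otimes> (y q \<otimes> b)"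
        "\<And>q. q \<in> U \<Longrightarrow> \<exists>u\<in>carrier R - q. u \<otimes> (e \<otimes> x q) = u \<otimes> (y q \<otimes> c)"
        unfolding I by auto
      show ?thesis unfolding I
      proof (intro conjI bexI[of _ "b \<oplus> c" "carrier R"] ballI)
        fix q assume q: "q \<in> U"
        interpret fractions R "carrier R - q" using fractions_prime[OF prime[OF q]] .
        obtain u v where uv: "u \<in> carrier R - q" "u \<otimes> (d \<otimes> x q) = u \<otimes> (y q \<otimes> b)"
          "v \<in> carrier R - q" "v \<otimes> (e \<otimes> x q) = v \<otimes> (y q \<otimes> c)" using bc(5,6)[OF q] by auto
        have c: "u \<in> carrier R" "v \<in> carrier R" "x q \<in> carrier R" "y q \<in> carrier R"
          using uv xy(1)[OF q] yc[OF q] by auto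
        have "(u \<otimes> v) \<otimes> ((d \<oplus> e) \<otimes> x q) = v \<otimes> (u \<otimes> (d \<otimes> x q)) \<oplus> u \<otimes> (v \<otimes> (e \<otimes> x q))"
          using c bc by (simp add: m_ac l_distr r_distr)
        also have "\<dots> = (u \<otimes> v) \<otimes> (y q \<otimes> (b \<oplus> c))"
          unfolding uv using c bc by (simp add: m_ac r_distr)
        finally show "\<exists>u\<in>carrier R - q. u \<otimes> ((d \<oplus> e) \<otimes> x q) = u \<otimes> (y q \<otimes> (b \<oplus> c))"
          using M_mult[OF uv(1,3)] by blast
      qed (use bc in auto)
    qed
    show "r \<otimes> d \<in> ?I" if "d \<in> ?I" and r: "r \<in> carrier R" for d r
    proof -
      from that obtain b where b: "d \<in> carrier R" "b \<in> carrier R"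
        "\<And>q. q \<in> U \<Longrightarrow> \<exists>u\<in>carrier R - q. u \<otimes> (d \<otimes> x q) = u \<otimes> (y q \<otimes> b)"
        unfolding I by auto
      show ?thesis unfolding I
      proof (intro conjI bexI[of _ "r \<otimes> b" "carrier R"] ballI)
        fix q assume q: "q \<in> U"
        obtain u where u: "u \<in> carrier R - q" "u \<otimes> (d \<otimes> x q) = u \<otimes> (y q \<otimes> b)"
          using b(3)[OF q] by auto
        have "u \<otimes> ((r \<otimes> d) \<otimes> x q) = r \<otimes> (u \<otimes> (d \<otimes> x q))"
          using b(1,2) u(1) r xy(1)[OF q] by (simp add: m_ac)
        also have "\<dots> = u \<otimes> (y q \<otimes> (r \<otimes> b))"
          unfolding u(2) using b(1,2) u(1) r yc[OF q] by (simp add: m_ac)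
        finally show "\<exists>u\<in>carrier R - q. u \<otimes> ((r \<otimes> d) \<otimes> x q) = u \<otimes> (y q \<otimes> (r \<otimes> b))"
          using u(1) by blast
      qed (use b r in auto)
    qed
  qed auto
qed

text \<open>The annihilator of \<open>x - y\<close> is contained in no prime of \<open>D(g)\<close>, so it contains a power
  of \<open>g\<close>.\<close>

lemma (in cring) vanishing_on_basic_open:
  assumes c: "g \<in> carrier R" "x \<in> carrier R" "y \<in> carrier R"
    and loc: "\<And>q. q \<in> basic_open R g \<Longrightarrow> \<exists>u\<in>carrier R - q. u \<otimes> x = u \<otimes> y"
  shows "\<exists>n::nat. g [^] n \<otimes> x = g [^] n \<otimes> y"
proof -
  note eq = diff_zero_iff[OF _ c(2,3)]
  have "ideal {u \<in> carrier R. u \<otimes> (x \<ominus> y) \<in> {\<zero>}} R"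
    using c by (intro colon_ideal zeroideal) auto
  then have "\<exists>n::nat. g [^] n \<in> {u \<in> carrier R. u \<otimes> (x \<ominus> y) \<in> {\<zero>}}"
  proof (rule power_mem_ideal[OF _ c(1)])
    fix p assume "primeideal p R" "g \<notin> p"
    then show "\<not> {u \<in> carrier R. u \<otimes> (x \<ominus> y) \<in> {\<zero>}} \<subseteq> p"
      using loc[of p] eq by (auto simp: basic_open_def)
  qed
  then show ?thesis using eq by auto
qed

text \<open>By definition \<open>s\<close> is a fraction near every point, hence on basic open sets covering
  \<open>D(g)\<close>. The functions \<open>k\<close> defining them generate an ideal containing a power of \<open>g\<close>, and that
  power already lies in the ideal generated by finitely many of them.\<close>

lemma (in cring) section_local_fractions:
  assumes g: "g \<in> carrier R" and s: "s \<in> carrier (spec_sections R (basic_open R g))"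
  obtains F a f where "finite F" "F \<subseteq> carrier R"
    "\<And>q. q \<in> basic_open R g \<Longrightarrow> \<exists>k\<in>F. k \<notin> q"
    "\<And>k. k \<in> F \<Longrightarrow> a k \<in> carrier R \<and> f k \<in> carrier R"
    "\<And>k q. k \<in> F \<Longrightarrow> q \<in> basic_open R k \<Longrightarrow> f k \<notin> q \<and> s q = frac_at R q (a k) (f k)"
proof -
  let ?K = "{k \<in> carrier R. \<exists>a f. a \<in> carrier R \<and> f \<in> carrier R \<and>
      (\<forall>q\<in>basic_open R k. f \<notin> q \<and> s q = frac_at R q a f)}"
  have cover: "\<exists>k\<in>?K. k \<notin> p" if p: "p \<in> basic_open R g" for p
  proof -
    obtain V a f where V: "openin (zariski R) V" "p \<in> V" "a \<in> carrier R" "f \<in> carrier R"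
      "\<forall>q\<in>V. f \<notin> q \<and> s q = frac_at R q a f"
      using s p unfolding spec_sections_def by auto
    obtain k where k: "k \<in> carrier R" "p \<in> basic_open R k" "basic_open R k \<subseteq> V"
      using zariski_basis[OF V(1,2)] .
    then have "k \<in> ?K" using V by blast
    moreover have "k \<notin> p" using k by (simp add: basic_open_def)
    ultimately show ?thesis by blast
  qed
  have Kid: "ideal (genideal R ?K) R" by (rule genideal_ideal) auto
  have Kself: "?K \<subseteq> genideal R ?K" by (rule genideal_self) auto
  have "\<exists>n::nat. g [^] n \<in> genideal R ?K"
  proof (rule power_mem_ideal[OF Kid g])
    fix p assume "primeideal p R" "g \<notin> p"
    then obtain k where "k \<in> ?K" "k \<notin> p" using cover[of p] by (auto simp: basic_open_def)
    then show "\<not> genideal R ?K \<subseteq> p" using Kself by blast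
  qed
  then obtain n where n: "g [^] (n::nat) \<in> genideal R ?K" ..
  obtain F where F: "finite F" "F \<subseteq> ?K" "g [^] n \<in> genideal R F"
    by (rule finite_subset_genideal[OF _ n]) auto
  have "\<exists>k\<in>F. k \<notin> q" if q: "q \<in> basic_open R g" for q
  proof (rule ccontr)
    assume "\<not> ?thesis"
    then have Fq: "F \<subseteq> q" by blast
    interpret q: primeideal q R using q by (simp add: basic_open_def)
    have "g [^] n \<in> q" using genideal_minimal[OF q.is_ideal Fq] F(3) by blast
    then show False using q.pow_mem_imp_mem[OF g] q by (simp add: basic_open_def)
  qed
  moreover have "\<forall>k\<in>F. \<exists>a f. a \<in> carrier R \<and> f \<in> carrier R \<and>
      (\<forall>q\<in>basic_open R k. f \<notin> q \<and> s q = frac_at R q a f)" using F(2) by blast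
  then obtain a f where "\<forall>k\<in>F. a k \<in> carrier R \<and> f k \<in> carrier R \<and>
      (\<forall>q\<in>basic_open R k. f k \<notin> q \<and> s q = frac_at R q (a k) (f k))" by metis
  moreover have "F \<subseteq> carrier R" using F(2) by blast
  ultimately show thesis using F(1) that[of F a f] by blast
qed

text \<open>The sections over \<open>D(g)\<close> are the fractions with denominator a power of \<open>g\<close>. By
  \<open>power_mem_ideal\<close> it is enough to find, for every \<open>p \<in> D(g)\<close>, a denominator of \<open>s\<close> outside \<open>p\<close>.
  Let \<open>s = a\<^sub>k / f\<^sub>k\<close> on \<open>D(k)\<close> for \<open>k\<close> in a finite set, and choose \<open>k\<close> with \<open>p \<in> D(k)\<close>. For every
  \<open>j\<close> the two fractions agree on \<open>D(k j)\<close>, so \<open>(k j)\<^sup>N (f\<^sub>k a\<^sub>j - f\<^sub>j a\<^sub>k) = 0\<close> for a common exponent \<open>N\<close>.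
  Since \<open>j\<close> is invertible on \<open>D(j)\<close>, this says that \<open>k\<^sup>N f\<^sub>k s = k\<^sup>N a\<^sub>k\<close> on each \<open>D(j)\<close>, and \<open>k\<^sup>N f\<^sub>k\<close> is
  the desired denominator.\<close>

theorem (in cring) section_on_basic_open:
  assumes g: "g \<in> carrier R" and s: "s \<in> carrier (spec_sections R (basic_open R g))"
  shows "\<exists>(n::nat). \<exists>b\<in>carrier R. \<forall>q\<in>basic_open R g. s q = frac_at R q b (g [^] n)"
proof -
  obtain F a f where F: "finite F" "F \<subseteq> carrier R"
    and cover: "\<And>q. q \<in> basic_open R g \<Longrightarrow> \<exists>k\<in>F. k \<notin> q"
    and af: "\<And>k. k \<in> F \<Longrightarrow> a k \<in> carrier R \<and> f k \<in> carrier R"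
    and sF: "\<And>k q. k \<in> F \<Longrightarrow> q \<in> basic_open R k \<Longrightarrow> f k \<notin> q \<and> s q = frac_at R q (a k) (f k)"
    by (rule section_local_fractions[OF g s]) (rule that)
  let ?I = "{d \<in> carrier R. \<exists>b\<in>carrier R. \<forall>q\<in>basic_open R g.
    frac_at R q d \<one> \<otimes>\<^bsub>localization_at R q\<^esub> s q = frac_at R q b \<one>}"
  have pr: "primeideal q R" if "q \<in> basic_open R g" for q using that by (simp add: basic_open_def)
  have sc: "s q \<in> carrier (localization_at R q)" if "q \<in> basic_open R g" for q
    using s that unfolding spec_sections_def by auto
  have "ideal ?I R" by (rule denominators_ideal[OF pr sc])
  then have "\<exists>n::nat. g [^] n \<in> ?I"
  proof (rule power_mem_ideal[OF _ g])
    fix p assume p: "primeideal p R" "g \<notin> p"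
    interpret p: primeideal p R by fact
    interpret Lp: fractions R "carrier R - p" by (rule fractions_prime[OF p(1)])
    obtain k where k: "k \<in> F" "k \<notin> p" using cover[of p] p by (auto simp: basic_open_def)
    have kc: "k \<in> carrier R" using k F by blast
    have "\<exists>m::nat. (k \<otimes> j) [^] m \<otimes> (f k \<otimes> a j) = (k \<otimes> j) [^] m \<otimes> (f j \<otimes> a k)" if j: "j \<in> F" for j
    proof (rule vanishing_on_basic_open)
      have jc: "j \<in> carrier R" using j F by blast
      fix q assume q: "q \<in> basic_open R (k \<otimes> j)"
      interpret q: primeideal q R using q by (simp add: basic_open_def)
      interpret Lq: fractions R "carrier R - q" by (rule fractions_prime[OF q.primeideal_axioms])
      have kj: "k \<otimes> j \<notin> q" using q by (simp add: basic_open_def)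
      have "k \<notin> q" using kj q.I_r_closed[OF _ jc] by metis
      moreover have "j \<notin> q" using kj q.I_l_closed[OF _ kc] by metis
      ultimately have "q \<in> basic_open R k" "q \<in> basic_open R j"
        using q.primeideal_axioms by (auto simp: basic_open_def)
      then have "f k \<notin> q" "f j \<notin> q" "frac_at R q (a j) (f j) = frac_at R q (a k) (f k)"
        using sF[OF k(1)] sF[OF j] by auto
      then show "\<exists>u\<in>carrier R - q. u \<otimes> (f k \<otimes> a j) = u \<otimes> (f j \<otimes> a k)"
        using af[OF k(1)] af[OF j] Lq.cls_eq_iff[of "a j" "f j" "a k" "f k"] by simp
    qed (use kc j F af[OF k(1)] af[OF j] in auto)
    then obtain m where m: "\<And>j. j \<in> F \<Longrightarrow>
      (k \<otimes> j) [^] (m j :: nat) \<otimes> (f k \<otimes> a j) = (k \<otimes> j) [^] m j \<otimes> (f j \<otimes> a k)" by metis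
    \<comment> \<open>The sum serves only as a common bound of the exponents.\<close>
    define N where "N = (\<Sum>j\<in>F. m j)"
    have N: "(k \<otimes> j) [^] N \<otimes> (f k \<otimes> a j) = (k \<otimes> j) [^] N \<otimes> (f j \<otimes> a k)" if j: "j \<in> F" for j
    proof -
      have jc: "j \<in> carrier R" using j F by blast
      have "m j \<le> N" unfolding N_def using F(1) j by (intro member_le_sum) auto
      then have e: "(k \<otimes> j) [^] N = (k \<otimes> j) [^] (N - m j) \<otimes> (k \<otimes> j) [^] m j"
        using kc jc by (simp add: nat_pow_mult)
      show ?thesis unfolding e using m[OF j] kc jc af[OF j] af[OF k(1)]
        by (simp add: m_assoc)
    qed
    let ?d = "k [^] N \<otimes> f k" and ?b = "k [^] N \<otimes> a k"
    have "?d \<in> ?I"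
    proof (intro CollectI conjI bexI[of _ ?b] ballI)
      fix q assume q: "q \<in> basic_open R g"
      interpret q: primeideal q R by (rule pr[OF q])
      interpret Lq: fractions R "carrier R - q" by (rule fractions_prime[OF q.primeideal_axioms])
      obtain j where j: "j \<in> F" "j \<notin> q" using cover[OF q] by blast
      have jc: "j \<in> carrier R" using j F by blast
      have "q \<in> basic_open R j" using j(2) q.primeideal_axioms by (simp add: basic_open_def)
      then have fj: "f j \<notin> q" and sq: "s q = frac_at R q (a j) (f j)" using sF[OF j(1)] by auto
      have "j [^] N \<otimes> (?d \<otimes> a j) = (k \<otimes> j) [^] N \<otimes> (f k \<otimes> a j)"
        using kc jc af[OF j(1)] af[OF k(1)] by (simp add: nat_pow_distrib m_ac)
      also have "\<dots> = j [^] N \<otimes> (f j \<otimes> ?b)"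
        unfolding N[OF j(1)] using kc jc af[OF j(1)] af[OF k(1)] by (simp add: nat_pow_distrib m_ac)
      finally have "j [^] N \<otimes> (?d \<otimes> a j) = j [^] N \<otimes> (f j \<otimes> ?b)" .
      moreover have "j [^] N \<in> carrier R - q" using q.pow_mem_imp_mem[OF jc] j(2) jc by auto
      ultimately show "frac_at R q ?d \<one> \<otimes>\<^bsub>localization_at R q\<^esub> s q = frac_at R q ?b \<one>"
        unfolding sq using kc af[OF j(1)] af[OF k(1)] fj
        by (subst Lq.mult_eq_const_iff) (simp_all, blast?)
    qed (use kc af[OF k(1)] in auto)
    moreover have "?d \<notin> p"
    proof -
      have "p \<in> basic_open R k" using k(2) p(1) by (simp add: basic_open_def)
      then have "f k \<notin> p" using sF[OF k(1)] by simp
      moreover have "k [^] N \<notin> p" using p.pow_mem_imp_mem[OF kc] k(2) by auto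
      ultimately show ?thesis using Lp.M_mult[of "k [^] N" "f k"] kc af[OF k(1)] by simp
    qed
    ultimately show "\<not> ?I \<subseteq> p" by blast
  qed
  then obtain n b where b: "b \<in> carrier R" and e: "\<And>q. q \<in> basic_open R g \<Longrightarrow>
    frac_at R q (g [^] (n::nat)) \<one> \<otimes>\<^bsub>localization_at R q\<^esub> s q = frac_at R q b \<one>" by auto
  have "s q = frac_at R q b (g [^] n)" if q: "q \<in> basic_open R g" for q
  proof -
    interpret q: primeideal q R by (rule pr[OF q])
    interpret Lq: fractions R "carrier R - q" by (rule fractions_prime[OF q.primeideal_axioms])
    have gn: "g [^] n \<in> carrier R - q" using q.pow_mem_imp_mem[OF g] q g by (auto simp: basic_open_def)
    obtain x y where xy: "x \<in> carrier R" "y \<in> carrier R - q" "s q = frac_at R q x y"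
      using sc[OF q] by (rule Lq.carrier_localizationE)
    then obtain u where "u \<in> carrier R - q" "u \<otimes> (g [^] n \<otimes> x) = u \<otimes> (y \<otimes> b)"
      using e[OF q] b g by (auto simp: Lq.mult_eq_const_iff)
    then show ?thesis unfolding xy(3) using xy(1,2) b gn by (subst Lq.cls_eq_iff) blast+
  qed
  then show ?thesis using b by blast
qed

section \<open>The spectrum of a localization\<close>

text \<open>The ring \<open>A\<close> is characterized as the localization of \<open>R\<close> at \<open>M\<close> by the properties of the
  map \<open>\<phi>\<close>, not constructed from fractions. This makes it possible to take for \<open>A\<close> the ring of sections
  over an open subset of a ringed space, which has the element type that \<open>affine_open\<close> requires.\<close>

locale localization_map = fractions R M + A: cring A
  for R :: "('b, 'm) ring_scheme" (structure) and M and A :: "('c, 'n) ring_scheme" +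
  fixes \<phi> :: "'b \<Rightarrow> 'c"
  assumes hom: "\<phi> \<in> ring_hom R A"
    and unit: "\<And>m. m \<in> M \<Longrightarrow> \<exists>a\<in>carrier A. a \<otimes>\<^bsub>A\<^esub> \<phi> m = \<one>\<^bsub>A\<^esub>"
    and numerator: "\<And>a. a \<in> carrier A \<Longrightarrow> \<exists>m\<in>M. \<exists>r\<in>carrier R. \<phi> m \<otimes>\<^bsub>A\<^esub> a = \<phi> r"
    and kernel: "\<And>r r'. r \<in> carrier R \<Longrightarrow> r' \<in> carrier R \<Longrightarrow> \<phi> r = \<phi> r' \<Longrightarrow>
      \<exists>m\<in>M. m \<otimes> r = m \<otimes> r'"
begin

lemma phi_closed [simp]: "r \<in> carrier R \<Longrightarrow> \<phi> r \<in> carrier A"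
  and phi_mult: "r \<in> carrier R \<Longrightarrow> s \<in> carrier R \<Longrightarrow> \<phi> (r \<otimes> s) = \<phi> r \<otimes>\<^bsub>A\<^esub> \<phi> s"
  and phi_add: "r \<in> carrier R \<Longrightarrow> s \<in> carrier R \<Longrightarrow> \<phi> (r \<oplus> s) = \<phi> r \<oplus>\<^bsub>A\<^esub> \<phi> s"
  and phi_one: "\<phi> \<one> = \<one>\<^bsub>A\<^esub>"
  using hom by (auto simp: ring_hom_def)

lemma phi_zero: "\<phi> \<zero> = \<zero>\<^bsub>A\<^esub>"
  using ring_hom_zero[OF hom ring_axioms A.ring_axioms] .

definition locus :: "'b set set" where
  "locus = {p. primeideal p R \<and> p \<inter> M = {}}"

text \<open>The ideal generated by \<open>\<phi> ` p\<close>, written with fractions.\<close>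

definition extend :: "'b set \<Rightarrow> 'c set" where
  "extend p = {a \<in> carrier A. \<exists>m\<in>M. \<exists>r\<in>p. \<phi> m \<otimes>\<^bsub>A\<^esub> a = \<phi> r}"

definition contract :: "'c set \<Rightarrow> 'b set" where
  "contract q = {r \<in> carrier R. \<phi> r \<in> q}"

lemma locus_prime: "p \<in> locus \<Longrightarrow> primeideal p R"
  and locus_disjoint: "p \<in> locus \<Longrightarrow> m \<in> M \<Longrightarrow> m \<notin> p"
  by (auto simp: locus_def)

lemma mem_carrier: "p \<in> locus \<Longrightarrow> r \<in> p \<Longrightarrow> r \<in> carrier R"
  using ideal.Icarr[OF primeideal.axioms(1)[OF locus_prime]] .

lemma mult_mem_iff:
  assumes "p \<in> locus" "m \<in> M" "r \<in> carrier R"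
  shows "m \<otimes> r \<in> p \<longleftrightarrow> r \<in> p"
proof -
  interpret p: primeideal p R by (rule locus_prime[OF assms(1)])
  show ?thesis using p.I_prime[of m r] p.I_l_closed[of r m] locus_disjoint[OF assms(1,2)] assms(3)
      M_carr[OF assms(2)] by metis
qed

text \<open>Whether a fraction lies in \<open>extend p\<close> can be decided from any numerator, because
  elements of \<open>M\<close> can be cancelled modulo \<open>p\<close>.\<close>

lemma mem_extend_iff:
  assumes p: "p \<in> locus" and "a \<in> carrier A" "m \<in> M" "r \<in> carrier R" "\<phi> m \<otimes>\<^bsub>A\<^esub> a = \<phi> r"
  shows "a \<in> extend p \<longleftrightarrow> r \<in> p"
proof
  assume "r \<in> p" then show "a \<in> extend p" using assms by (auto simp: extend_def)
next
  assume "a \<in> extend p"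
  then obtain n s where ns: "n \<in> M" "s \<in> p" "\<phi> n \<otimes>\<^bsub>A\<^esub> a = \<phi> s" by (auto simp: extend_def)
  note c = M_carr[OF ns(1)] M_carr[OF assms(3)] mem_carrier[OF p ns(2)] assms(2,4)
  have "\<phi> (n \<otimes> r) = \<phi> n \<otimes>\<^bsub>A\<^esub> (\<phi> m \<otimes>\<^bsub>A\<^esub> a)" unfolding assms(5) using c by (simp add: phi_mult)
  also have "\<dots> = \<phi> m \<otimes>\<^bsub>A\<^esub> (\<phi> n \<otimes>\<^bsub>A\<^esub> a)" using c by (simp add: A.m_lcomm)
  also have "\<dots> = \<phi> (m \<otimes> s)" unfolding ns(3) using c by (simp add: phi_mult)
  finally obtain k where k: "k \<in> M" "k \<otimes> (n \<otimes> r) = k \<otimes> (m \<otimes> s)"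
    using kernel[of "n \<otimes> r" "m \<otimes> s"] c by auto
  have "k \<otimes> (m \<otimes> s) \<in> p" using ns(2) c k(1) assms(3) by (simp add: mult_mem_iff[OF p])
  then show "r \<in> p" using c k(1) ns(1) by (simp add: mult_mem_iff[OF p] flip: k(2))
qed

lemma phi_mem_extend_iff:
  assumes "p \<in> locus" "r \<in> carrier R"
  shows "\<phi> r \<in> extend p \<longleftrightarrow> r \<in> p"
  using assms by (intro mem_extend_iff[of _ _ \<one>]) (auto simp: phi_one)

lemma extend_prime:
  assumes p: "p \<in> locus"
  shows "primeideal (extend p) A"
proof -
  interpret p: primeideal p R by (rule locus_prime[OF p])
  note I = mem_extend_iff[OF p]
  show ?thesis
  proof (rule primeidealI)
    show "ideal (extend p) A"
    proof (rule A.ideal_closedI)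
      show "extend p \<subseteq> carrier A" by (auto simp: extend_def)
      show "\<zero>\<^bsub>A\<^esub> \<in> extend p" using I[of "\<zero>\<^bsub>A\<^esub>" \<one> \<zero>] by (simp add: phi_one phi_zero p.zero_closed)
      show "a \<oplus>\<^bsub>A\<^esub> b \<in> extend p" if "a \<in> extend p" "b \<in> extend p" for a b
      proof -
        obtain m r n s where h: "a \<in> carrier A" "b \<in> carrier A" "m \<in> M" "n \<in> M" "r \<in> p" "s \<in> p"
          "\<phi> m \<otimes>\<^bsub>A\<^esub> a = \<phi> r" "\<phi> n \<otimes>\<^bsub>A\<^esub> b = \<phi> s" using \<open>a \<in> extend p\<close> \<open>b \<in> extend p\<close> by (auto simp: extend_def)
        note c = h(1,2) M_carr[OF h(3)] M_carr[OF h(4)] p.Icarr[OF h(5)] p.Icarr[OF h(6)]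
        have "\<phi> (m \<otimes> n) \<otimes>\<^bsub>A\<^esub> (a \<oplus>\<^bsub>A\<^esub> b) =
            \<phi> n \<otimes>\<^bsub>A\<^esub> (\<phi> m \<otimes>\<^bsub>A\<^esub> a) \<oplus>\<^bsub>A\<^esub> \<phi> m \<otimes>\<^bsub>A\<^esub> (\<phi> n \<otimes>\<^bsub>A\<^esub> b)"
          using c by (simp add: phi_mult A.r_distr A.m_ac)
        also have "\<dots> = \<phi> (n \<otimes> r \<oplus> m \<otimes> s)" unfolding h(7,8) using c by (simp add: phi_mult phi_add)
        finally show ?thesis using h(3-6) c
          by (subst I[of _ "m \<otimes> n" "n \<otimes> r \<oplus> m \<otimes> s"]) (auto intro: p.a_closed p.I_l_closed)
      qed
      show "x \<otimes>\<^bsub>A\<^esub> a \<in> extend p" if "a \<in> extend p" and x: "x \<in> carrier A" for a x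
      proof -
        obtain m r where h: "a \<in> carrier A" "m \<in> M" "r \<in> p" "\<phi> m \<otimes>\<^bsub>A\<^esub> a = \<phi> r"
          using \<open>a \<in> extend p\<close> by (auto simp: extend_def)
        obtain n y where y: "n \<in> M" "y \<in> carrier R" "\<phi> n \<otimes>\<^bsub>A\<^esub> x = \<phi> y" using numerator[OF x] by auto
        note c = h(1) x y(2) M_carr[OF h(2)] M_carr[OF y(1)] p.Icarr[OF h(3)]
        have "\<phi> (n \<otimes> m) \<otimes>\<^bsub>A\<^esub> (x \<otimes>\<^bsub>A\<^esub> a) = (\<phi> n \<otimes>\<^bsub>A\<^esub> x) \<otimes>\<^bsub>A\<^esub> (\<phi> m \<otimes>\<^bsub>A\<^esub> a)"
          using c by (simp add: phi_mult A.m_ac)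
        also have "\<dots> = \<phi> (y \<otimes> r)" unfolding h(4) y(3) using c by (simp add: phi_mult)
        finally show ?thesis using h(2,3) y(1) c
          by (subst I[of _ "n \<otimes> m" "y \<otimes> r"]) (auto intro: p.I_l_closed)
      qed
    qed
    show "cring A" by (rule A.is_cring)
    have "\<one> \<notin> p" using locus_disjoint[OF p M_one] .
    then show "carrier A \<noteq> extend p" using phi_mem_extend_iff[OF p, of \<one>] by (auto simp: phi_one)
    fix a b assume ab: "a \<in> carrier A" "b \<in> carrier A" "a \<otimes>\<^bsub>A\<^esub> b \<in> extend p"
    obtain m r where r: "m \<in> M" "r \<in> carrier R" "\<phi> m \<otimes>\<^bsub>A\<^esub> a = \<phi> r" using numerator[OF ab(1)] by auto
    obtain n s where s: "n \<in> M" "s \<in> carrier R" "\<phi> n \<otimes>\<^bsub>A\<^esub> b = \<phi> s" using numerator[OF ab(2)] by auto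
    note c = ab(1,2) r(2) s(2) M_carr[OF r(1)] M_carr[OF s(1)]
    have "\<phi> (m \<otimes> n) \<otimes>\<^bsub>A\<^esub> (a \<otimes>\<^bsub>A\<^esub> b) = (\<phi> m \<otimes>\<^bsub>A\<^esub> a) \<otimes>\<^bsub>A\<^esub> (\<phi> n \<otimes>\<^bsub>A\<^esub> b)"
      using c by (simp add: phi_mult A.m_ac)
    also have "\<dots> = \<phi> (r \<otimes> s)" unfolding r(3) s(3) using c by (simp add: phi_mult)
    finally have "r \<otimes> s \<in> p" using ab(3) I[of "a \<otimes>\<^bsub>A\<^esub> b" "m \<otimes> n" "r \<otimes> s"] c r(1) s(1) by simp
    then have "r \<in> p \<or> s \<in> p" using p.I_prime[OF c(3,4)] by blast
    then show "a \<in> extend p \<or> b \<in> extend p"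
      using I[OF c(1) r] I[OF c(2) s] by blast
  qed
qed

lemma phi_notin_prime:
  assumes q: "primeideal q A" and m: "m \<in> M"
  shows "\<phi> m \<notin> q"
proof
  assume a: "\<phi> m \<in> q"
  interpret q: primeideal q A by (rule q)
  have "\<one>\<^bsub>A\<^esub> \<in> q" using unit[OF m] q.I_l_closed[OF a] by metis
  then show False using q.one_imp_carrier q.I_notcarr by simp
qed

lemma contract_in_locus:
  assumes q: "primeideal q A"
  shows "contract q \<in> locus"
proof -
  interpret h: ring_hom_ring R A \<phi>
    by (rule ring_hom_ringI2[OF ring_axioms A.ring_axioms hom])
  have "primeideal (contract q) R"
    unfolding contract_def using h.primeideal_vimage[OF is_cring q] .
  then show ?thesis using phi_notin_prime[OF q] by (auto simp: locus_def contract_def)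
qed

lemma contract_extend:
  assumes "p \<in> locus" shows "contract (extend p) = p"
  using phi_mem_extend_iff[OF assms] mem_carrier[OF assms] by (auto simp: contract_def)

lemma extend_contract:
  assumes q: "primeideal q A" shows "extend (contract q) = q"
proof -
  interpret q: primeideal q A by (rule q)
  have "a \<in> extend (contract q) \<longleftrightarrow> a \<in> q" if a: "a \<in> carrier A" for a
  proof -
    obtain m r where r: "m \<in> M" "r \<in> carrier R" "\<phi> m \<otimes>\<^bsub>A\<^esub> a = \<phi> r" using numerator[OF a] by auto
    have "a \<in> extend (contract q) \<longleftrightarrow> \<phi> r \<in> q"
      using mem_extend_iff[OF contract_in_locus[OF q] a r] r(2) by (simp add: contract_def)
    also have "\<dots> \<longleftrightarrow> a \<in> q"
      using q.I_prime[of "\<phi> m" a] q.I_l_closed[of a "\<phi> m"] phi_notin_prime[OF q r(1)] a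
        phi_closed[OF M_carr[OF r(1)]] unfolding r(3)[symmetric] by metis
    finally show ?thesis .
  qed
  moreover have "extend (contract q) \<subseteq> carrier A" by (auto simp: extend_def)
  ultimately show ?thesis using q.Icarr by blast
qed

text \<open>Shows that the preimage of an open set under \<open>extend\<close> is open: the numerators of \<open>E\<close> define it.\<close>

lemma extend_image_iff:
  assumes "p \<in> locus" "E \<subseteq> carrier A"
  shows "E \<subseteq> extend p \<longleftrightarrow> {r \<in> carrier R. \<exists>m\<in>M. \<exists>a\<in>E. \<phi> m \<otimes>\<^bsub>A\<^esub> a = \<phi> r} \<subseteq> p"
proof
  assume "E \<subseteq> extend p"
  then show "{r \<in> carrier R. \<exists>m\<in>M. \<exists>a\<in>E. \<phi> m \<otimes>\<^bsub>A\<^esub> a = \<phi> r} \<subseteq> p"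
    using mem_extend_iff[OF assms(1)] assms(2) by blast
next
  assume r: "{r \<in> carrier R. \<exists>m\<in>M. \<exists>a\<in>E. \<phi> m \<otimes>\<^bsub>A\<^esub> a = \<phi> r} \<subseteq> p"
  show "E \<subseteq> extend p"
  proof
    fix a assume a: "a \<in> E"
    then have ac: "a \<in> carrier A" using assms(2) by blast
    obtain m r where "m \<in> M" "r \<in> carrier R" "\<phi> m \<otimes>\<^bsub>A\<^esub> a = \<phi> r" using numerator[OF ac] by auto
    then show "a \<in> extend p" using r a mem_extend_iff[OF assms(1) ac] by blast
  qed
qed

lemma homeomorphic_extend:
  assumes locus: "openin (zariski R) locus"
  shows "homeomorphic_maps (subtopology (zariski R) locus) (zariski A) extend contract"
proof -
  have ts: "topspace (subtopology (zariski R) locus) = locus"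
    using openin_subset[OF locus] by auto
  have 1: "continuous_map (subtopology (zariski R) locus) (zariski A) extend"
    unfolding continuous_map_def ts topspace_zariski
  proof (intro conjI allI impI)
    show "extend \<in> locus \<rightarrow> {p. primeideal p A}" using extend_prime by auto
    fix V assume "openin (zariski A) V"
    then obtain E where E: "E \<subseteq> carrier A" "V = {p. primeideal p A \<and> \<not> E \<subseteq> p}"
      unfolding openin_zariski by blast
    let ?E = "{r \<in> carrier R. \<exists>m\<in>M. \<exists>a\<in>E. \<phi> m \<otimes>\<^bsub>A\<^esub> a = \<phi> r}"
    have "{x \<in> locus. extend x \<in> V} = {p. primeideal p R \<and> \<not> ?E \<subseteq> p} \<inter> locus"
    proof (rule Set.set_eqI)
      fix p
      show "p \<in> {x \<in> locus. extend x \<in> V} \<longleftrightarrow> p \<in> {p. primeideal p R \<and> \<not> ?E \<subseteq> p} \<inter> locus"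
        using extend_image_iff[OF _ E(1), of p] locus_prime[of p] extend_prime[of p] unfolding E(2)
        by (cases "p \<in> locus") simp_all
    qed
    moreover have "openin (zariski R) {p. primeideal p R \<and> \<not> ?E \<subseteq> p}"
      unfolding openin_zariski by (intro exI[of _ ?E]) auto
    ultimately show "openin (subtopology (zariski R) locus) {x \<in> locus. extend x \<in> V}"
      unfolding openin_subtopology by blast
  qed
  have 2: "continuous_map (zariski A) (subtopology (zariski R) locus) contract"
    unfolding continuous_map_def ts topspace_zariski
  proof (intro conjI allI impI)
    show "contract \<in> {p. primeideal p A} \<rightarrow> locus" using contract_in_locus by auto
    fix U assume "openin (subtopology (zariski R) locus) U"
    then obtain V where V: "openin (zariski R) V" "U = V \<inter> locus" unfolding openin_subtopology by blast
    then obtain E where E: "E \<subseteq> carrier R" "V = {p. primeideal p R \<and> \<not> E \<subseteq> p}"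
      unfolding openin_zariski by blast
    have "E \<subseteq> contract q \<longleftrightarrow> \<phi> ` E \<subseteq> q" for q using E(1) by (auto simp: contract_def)
    then have "{q \<in> {p. primeideal p A}. contract q \<in> U} = {q. primeideal q A \<and> \<not> \<phi> ` E \<subseteq> q}"
      unfolding V(2) E(2) using contract_in_locus locus_prime by auto
    moreover have "openin (zariski A) {q. primeideal q A \<and> \<not> \<phi> ` E \<subseteq> q}"
      unfolding openin_zariski using E(1) by (intro exI[of _ "\<phi> ` E"]) auto
    ultimately show "openin (zariski A) {q \<in> {p. primeideal p A}. contract q \<in> U}" by simp
  qed
  show ?thesis unfolding homeomorphic_maps_def ts topspace_zariski
    using 1 2 contract_extend extend_contract by auto
qed

text \<open>The isomorphism from the local ring of \<open>A\<close> at \<open>extend p\<close> to that of \<open>R\<close> at \<open>p\<close>. As the elements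
  of local rings are classes of pairs, it can be defined without choices as a preimage of classes.\<close>

definition stalk_map :: "'b set \<Rightarrow> ('c \<times> 'c) set \<Rightarrow> ('b \<times> 'b) set" where
  "stalk_map p C = {(r, s). r \<in> carrier R \<and> s \<in> carrier R - p \<and> (\<phi> r, \<phi> s) \<in> C}"

abbreviation frR where "frR \<equiv> frac_at R"
abbreviation frA where "frA p \<equiv> frac_at A (extend p)"

lemma fractions_R: "p \<in> locus \<Longrightarrow> fractions R (carrier R - p)"
  using fractions_prime[OF locus_prime] .

lemma fractions_A: "p \<in> locus \<Longrightarrow> fractions A (carrier A - extend p)"
  using fractions_prime[OF extend_prime] .

lemma phi_denominator: "p \<in> locus \<Longrightarrow> s \<in> carrier R - p \<Longrightarrow> \<phi> s \<in> carrier A - extend p"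
  using phi_mem_extend_iff by auto

text \<open>The map \<open>r / s \<mapsto> \<phi> r / \<phi> s\<close> of local rings is well defined and injective.\<close>

lemma frac_phi_eq_iff:
  assumes p: "p \<in> locus" and c: "r \<in> carrier R" "s \<in> carrier R - p" "r' \<in> carrier R" "s' \<in> carrier R - p"
  shows "frA p (\<phi> r) (\<phi> s) = frA p (\<phi> r') (\<phi> s') \<longleftrightarrow> frR p r s = frR p r' s'"
proof -
  interpret LR: fractions R "carrier R - p" by (rule fractions_R[OF p])
  interpret LA: fractions A "carrier A - extend p" by (rule fractions_A[OF p])
  have sc: "s \<in> carrier R" "s' \<in> carrier R" using c by auto
  have "(\<exists>u\<in>carrier A - extend p. u \<otimes>\<^bsub>A\<^esub> (\<phi> s' \<otimes>\<^bsub>A\<^esub> \<phi> r) = u \<otimes>\<^bsub>A\<^esub> (\<phi> s \<otimes>\<^bsub>A\<^esub> \<phi> r')) \<longleftrightarrow>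
      (\<exists>u\<in>carrier R - p. u \<otimes> (s' \<otimes> r) = u \<otimes> (s \<otimes> r'))" (is "?a \<longleftrightarrow> ?b")
  proof
    assume ?b
    then obtain u where u: "u \<in> carrier R - p" "u \<otimes> (s' \<otimes> r) = u \<otimes> (s \<otimes> r')" by blast
    then have uc: "u \<in> carrier R" by simp
    have "\<phi> u \<otimes>\<^bsub>A\<^esub> (\<phi> s' \<otimes>\<^bsub>A\<^esub> \<phi> r) = \<phi> u \<otimes>\<^bsub>A\<^esub> (\<phi> s \<otimes>\<^bsub>A\<^esub> \<phi> r')"
      using arg_cong[OF u(2), of \<phi>] c(1,3) sc uc by (simp add: phi_mult)
    then show ?a using phi_denominator[OF p u(1)] by blast
  next
    assume ?a
    then obtain a where a: "a \<in> carrier A - extend p"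
      "a \<otimes>\<^bsub>A\<^esub> (\<phi> s' \<otimes>\<^bsub>A\<^esub> \<phi> r) = a \<otimes>\<^bsub>A\<^esub> (\<phi> s \<otimes>\<^bsub>A\<^esub> \<phi> r')" by blast
    have ac: "a \<in> carrier A" using a by simp
    obtain m x where x: "m \<in> M" "x \<in> carrier R" "\<phi> m \<otimes>\<^bsub>A\<^esub> a = \<phi> x" using numerator[OF ac] by auto
    have xp: "x \<in> carrier R - p" using mem_extend_iff[OF p ac x] a(1) x(2) by simp
    have mc: "\<phi> m \<in> carrier A" using M_carr[OF x(1)] by simp
    have "\<phi> (x \<otimes> (s' \<otimes> r)) = \<phi> m \<otimes>\<^bsub>A\<^esub> (a \<otimes>\<^bsub>A\<^esub> (\<phi> s' \<otimes>\<^bsub>A\<^esub> \<phi> r))"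
      using c(1,3) sc x(2) mc ac by (simp add: phi_mult A.m_assoc flip: x(3))
    also have "\<dots> = \<phi> (x \<otimes> (s \<otimes> r'))"
      unfolding a(2) using c(1,3) sc x(2) mc ac by (simp add: phi_mult A.m_assoc flip: x(3))
    finally obtain n where n: "n \<in> M" "n \<otimes> (x \<otimes> (s' \<otimes> r)) = n \<otimes> (x \<otimes> (s \<otimes> r'))"
      using kernel[of "x \<otimes> (s' \<otimes> r)" "x \<otimes> (s \<otimes> r')"] c(1,3) sc x(2) by auto
    have "(n \<otimes> x) \<otimes> (s' \<otimes> r) = (n \<otimes> x) \<otimes> (s \<otimes> r')"
      using n(2) M_carr[OF n(1)] c(1,3) sc x(2) by (simp add: m_assoc)
    moreover have "n \<otimes> x \<in> carrier R - p"
      using mult_mem_iff[OF p n(1) x(2)] xp M_carr[OF n(1)] by simp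
    ultimately show ?b by blast
  qed
  then show ?thesis using c phi_denominator[OF p c(2)] phi_denominator[OF p c(4)] 
      LA.cls_eq_iff[of "\<phi> r" "\<phi> s" "\<phi> r'" "\<phi> s'"] LR.cls_eq_iff[of r s r' s'] by simp
qed

text \<open>Every fraction over \<open>A\<close> can be written with numerator and denominator from \<open>R\<close>. The
  same pair works at all primes, which is why the map on sections preserves being given locally by a
  single fraction.\<close>

lemma frac_numerators:
  assumes ab: "a \<in> carrier A" "b \<in> carrier A"
  obtains r s where "r \<in> carrier R" "s \<in> carrier R"
    "\<And>p. p \<in> locus \<Longrightarrow> b \<notin> extend p \<Longrightarrow> s \<notin> p \<and> frA p a b = frA p (\<phi> r) (\<phi> s)"
proof -
  obtain m r where r: "m \<in> M" "r \<in> carrier R" "\<phi> m \<otimes>\<^bsub>A\<^esub> a = \<phi> r" using numerator[OF ab(1)] by auto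
  obtain n s where s: "n \<in> M" "s \<in> carrier R" "\<phi> n \<otimes>\<^bsub>A\<^esub> b = \<phi> s" using numerator[OF ab(2)] by auto
  note mc = M_carr[OF r(1)] M_carr[OF s(1)]
  show thesis
  proof (rule that)
    show "n \<otimes> r \<in> carrier R" "m \<otimes> s \<in> carrier R" using mc r(2) s(2) by auto
    fix p assume p: "p \<in> locus" "b \<notin> extend p"
    interpret LA: fractions A "carrier A - extend p" by (rule fractions_A[OF p(1)])
    have "s \<notin> p" using mem_extend_iff[OF p(1) ab(2) s] p(2) by simp
    then have 1: "m \<otimes> s \<notin> p" using mult_mem_iff[OF p(1) r(1) s(2)] by simp
    have "\<phi> (m \<otimes> s) \<otimes>\<^bsub>A\<^esub> a = \<phi> s \<otimes>\<^bsub>A\<^esub> (\<phi> m \<otimes>\<^bsub>A\<^esub> a)" using mc s(2) ab(1) by (simp add: phi_mult A.m_ac)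
    also have "\<dots> = b \<otimes>\<^bsub>A\<^esub> \<phi> (n \<otimes> r)"
      unfolding r(3) s(3)[symmetric] using mc r(2) ab(2) by (simp add: phi_mult A.m_ac)
    finally have "frA p a b = frA p (\<phi> (n \<otimes> r)) (\<phi> (m \<otimes> s))"
      using 1 mc r(2) s(2) ab p(2) phi_denominator[OF p(1), of "m \<otimes> s"] by (intro LA.cls_eqI) auto
    then show "m \<otimes> s \<notin> p \<and> frA p a b = frA p (\<phi> (n \<otimes> r)) (\<phi> (m \<otimes> s))" using 1 by simp
  qed
qed

lemma stalk_elementE:
  assumes p: "p \<in> locus" and C: "C \<in> carrier (localization_at A (extend p))"
  obtains r s where "r \<in> carrier R" "s \<in> carrier R - p" "C = frA p (\<phi> r) (\<phi> s)"
proof -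
  obtain a b where ab: "a \<in> carrier A" "b \<in> carrier A - extend p" "C = frA p a b"
    using fractions.carrier_localizationE[OF fractions_A[OF p] C] by metis
  then have "b \<in> carrier A" "b \<notin> extend p" by auto
  then show thesis using frac_numerators[OF ab(1), of b] p ab(3) that by (metis DiffI)
qed

lemma stalk_map_frac:
  assumes p: "p \<in> locus" and c: "r \<in> carrier R" "s \<in> carrier R - p"
  shows "stalk_map p (frA p (\<phi> r) (\<phi> s)) = frR p r s"
proof -
  have "(x, y) \<in> stalk_map p (frA p (\<phi> r) (\<phi> s)) \<longleftrightarrow> (x, y) \<in> frR p r s" for x y
    using fractions.mem_cls_iff[OF fractions_A[OF p], of "\<phi> r" "\<phi> s" "\<phi> x" "\<phi> y"]
      fractions.mem_cls_iff[OF fractions_R[OF p] c, of x y] frac_phi_eq_iff[OF p _ _ c, of x y]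
      c phi_denominator[OF p c(2)] phi_denominator[OF p, of y] by (auto simp: stalk_map_def)
  then show ?thesis by auto
qed

lemma stalk_map_closed:
  assumes "p \<in> locus" "C \<in> carrier (localization_at A (extend p))"
  shows "stalk_map p C \<in> carrier (localization_at R p)"
  using stalk_elementE[OF assms] stalk_map_frac[OF assms(1)]
    fractions.cls_closed[OF fractions_R[OF assms(1)]] by metis

lemma stalk_map_inj:
  assumes p: "p \<in> locus" and "C \<in> carrier (localization_at A (extend p))"
    "C' \<in> carrier (localization_at A (extend p))" "stalk_map p C = stalk_map p C'"
  shows "C = C'"
proof -
  obtain r s where r: "r \<in> carrier R" "s \<in> carrier R - p" "C = frA p (\<phi> r) (\<phi> s)"
    by (rule stalk_elementE[OF p assms(2)])
  obtain r' s' where r': "r' \<in> carrier R" "s' \<in> carrier R - p" "C' = frA p (\<phi> r') (\<phi> s')"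
    by (rule stalk_elementE[OF p assms(3)])
  show ?thesis using assms(4) frac_phi_eq_iff[OF p r(1,2) r'(1,2)]
    unfolding r(3) r'(3) stalk_map_frac[OF p r(1,2)] stalk_map_frac[OF p r'(1,2)] by simp
qed

lemma stalk_map_hom:
  assumes p: "p \<in> locus" and "C \<in> carrier (localization_at A (extend p))"
    "C' \<in> carrier (localization_at A (extend p))"
  shows "stalk_map p (C \<otimes>\<^bsub>localization_at A (extend p)\<^esub> C') =
      stalk_map p C \<otimes>\<^bsub>localization_at R p\<^esub> stalk_map p C'" (is ?m)
    and "stalk_map p (C \<oplus>\<^bsub>localization_at A (extend p)\<^esub> C') =
      stalk_map p C \<oplus>\<^bsub>localization_at R p\<^esub> stalk_map p C'" (is ?a)
proof -
  interpret LR: fractions R "carrier R - p" by (rule fractions_R[OF p])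
  interpret LA: fractions A "carrier A - extend p" by (rule fractions_A[OF p])
  obtain r s where r: "r \<in> carrier R" "s \<in> carrier R - p" "C = frA p (\<phi> r) (\<phi> s)"
    by (rule stalk_elementE[OF p assms(2)])
  obtain r' s' where r': "r' \<in> carrier R" "s' \<in> carrier R - p" "C' = frA p (\<phi> r') (\<phi> s')"
    by (rule stalk_elementE[OF p assms(3)])
  note c = r(1) r'(1) LR.M_carr[OF r(2)] LR.M_carr[OF r'(2)]
  note d = phi_denominator[OF p r(2)] phi_denominator[OF p r'(2)] phi_closed[OF c(1)] phi_closed[OF c(2)]
  have ss: "s \<otimes> s' \<in> carrier R - p" using LR.M_mult[OF r(2) r'(2)] .
  have "C \<otimes>\<^bsub>localization_at A (extend p)\<^esub> C' = frA p (\<phi> (r \<otimes> r')) (\<phi> (s \<otimes> s'))"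
    unfolding r(3) r'(3) LA.mult_cls[OF d(3,1,4,2)] using c by (simp add: phi_mult)
  then show ?m unfolding r(3) r'(3) stalk_map_frac[OF p r(1,2)] stalk_map_frac[OF p r'(1,2)]
    using stalk_map_frac[OF p _ ss, of "r \<otimes> r'"] LR.mult_cls[OF r(1,2) r'(1,2)] c by simp
  have "C \<oplus>\<^bsub>localization_at A (extend p)\<^esub> C' = frA p (\<phi> (s' \<otimes> r \<oplus> s \<otimes> r')) (\<phi> (s \<otimes> s'))"
    unfolding r(3) r'(3) LA.add_cls[OF d(3,1,4,2)] using c by (simp add: phi_mult phi_add)
  then show ?a unfolding r(3) r'(3) stalk_map_frac[OF p r(1,2)] stalk_map_frac[OF p r'(1,2)]
    using stalk_map_frac[OF p _ ss, of "s' \<otimes> r \<oplus> s \<otimes> r'"] LR.add_cls[OF r(1,2) r'(1,2)] c by simp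
qed

lemma stalk_map_one:
  assumes p: "p \<in> locus"
  shows "stalk_map p \<one>\<^bsub>localization_at A (extend p)\<^esub> = \<one>\<^bsub>localization_at R p\<^esub>"
  using stalk_map_frac[OF p one_closed fractions.M_one[OF fractions_R[OF p]]]
    fractions.one_cls[OF fractions_A[OF p]] fractions.one_cls[OF fractions_R[OF p]] by (simp add: phi_one)

definition section_map :: "'c set set \<Rightarrow> ('c set \<Rightarrow> ('c \<times> 'c) set) \<Rightarrow> 'b set \<Rightarrow> ('b \<times> 'b) set" where
  "section_map V t = (\<lambda>p\<in>{p \<in> locus. extend p \<in> V}. stalk_map p (t (extend p)))"

text \<open>The map is given stalkwise, so it is a homomorphism and injective because every \<open>stalk_map\<close>
  is. A section that is the fraction \<open>a / b\<close> on an open set \<open>W\<close> goes to one that is a single fraction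
  \<open>r / s\<close> on the preimage of \<open>W\<close>, by \<open>frac_numerators\<close>; conversely the stalkwise inverse of the section
  \<open>r / f\<close> is \<open>\<phi> r / \<phi> f\<close>, which gives surjectivity.\<close>

lemma section_map_iso:
  assumes locus: "openin (zariski R) locus" and V: "openin (zariski A) V"
  shows "section_map V \<in> ring_iso (spec_sections A V) (spec_sections R {p \<in> locus. extend p \<in> V})"
proof -
  let ?U = "{p \<in> locus. extend p \<in> V}"
  have homeo: "continuous_map (subtopology (zariski R) locus) (zariski A) extend"
    "continuous_map (zariski A) (subtopology (zariski R) locus) contract"
    using homeomorphic_extend[OF locus] by (auto simp: homeomorphic_maps_def)
  have ts: "topspace (subtopology (zariski R) locus) = locus"
    using openin_subset[OF locus] by auto
  have openR: "openin (zariski R) {p \<in> locus. extend p \<in> W}" if "openin (zariski A) W" for W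
    using openin_continuous_map_preimage[OF homeo(1) that] openin_trans_full[OF _ locus]
    unfolding ts by blast
  have openA: "openin (zariski A) {q. primeideal q A \<and> contract q \<in> W}" if "openin (zariski R) W" "W \<subseteq> locus" for W
    using openin_continuous_map_preimage[OF homeo(2), of W] that
    unfolding topspace_zariski by (simp add: openin_open_subtopology[OF locus])
  have Vp: "primeideal q A" if "q \<in> V" for q using openin_zariski_prime[OF V that] .
  have cU: "contract q \<in> ?U" if "q \<in> V" for q
    using contract_in_locus[OF Vp[OF that]] extend_contract[OF Vp[OF that]] that by simp
  have st: "t (extend p) \<in> carrier (localization_at A (extend p))"
    if "t \<in> carrier (spec_sections A V)" "p \<in> ?U" for t p
    using that unfolding spec_sections_def by auto
  have closed: "section_map V t \<in> carrier (spec_sections R ?U)" if t: "t \<in> carrier (spec_sections A V)" for t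
  proof -
    have "section_map V t \<in> (\<Pi>\<^sub>E p\<in>?U. carrier (localization_at R p))"
      unfolding section_map_def using stalk_map_closed st[OF t] by auto
    moreover have "\<exists>W. openin (zariski R) W \<and> p \<in> W \<and> W \<subseteq> ?U \<and>
         (\<exists>a\<in>carrier R. \<exists>f\<in>carrier R. \<forall>q\<in>W. f \<notin> q \<and> section_map V t q = frR q a f)" if p: "p \<in> ?U" for p
    proof -
      obtain W a b where W: "openin (zariski A) W" "extend p \<in> W" "W \<subseteq> V" and ab: "a \<in> carrier A" "b \<in> carrier A"
        "\<And>q. q \<in> W \<Longrightarrow> b \<notin> q \<and> t q = frac_at A q a b"
        using t p unfolding spec_sections_def by auto
      obtain r s where rs: "r \<in> carrier R" "s \<in> carrier R"
        "\<And>p. p \<in> locus \<Longrightarrow> b \<notin> extend p \<Longrightarrow> s \<notin> p \<and> frA p a b = frA p (\<phi> r) (\<phi> s)"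
        using frac_numerators[OF ab(1,2)] by metis
      have "s \<notin> p' \<and> section_map V t p' = frR p' r s" if p': "p' \<in> locus" "extend p' \<in> W" for p'
      proof -
        have 1: "s \<notin> p'" "t (extend p') = frA p' (\<phi> r) (\<phi> s)"
          using rs(3)[OF p'(1)] ab(3)[OF p'(2)] by auto
        have "p' \<in> ?U" using p' W(3) by auto
        then show ?thesis using 1 stalk_map_frac[OF p'(1) rs(1), of s] rs(2) by (simp add: section_map_def)
      qed
      then show ?thesis using openR[OF W(1)] W(2,3) p rs(1,2)
        by (intro exI[of _ "{p \<in> locus. extend p \<in> W}"] conjI bexI[of _ r] bexI[of _ s]) auto
    qed
    ultimately show ?thesis unfolding spec_sections_def by simp
  qed
  have inj: "inj_on (section_map V) (carrier (spec_sections A V))"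
  proof (rule inj_onI)
    fix t t' assume t: "t \<in> carrier (spec_sections A V)" "t' \<in> carrier (spec_sections A V)"
      and e: "section_map V t = section_map V t'"
    show "t = t'"
    proof (rule PiE_ext)
      show "t \<in> (\<Pi>\<^sub>E p\<in>V. carrier (localization_at A p))" "t' \<in> (\<Pi>\<^sub>E p\<in>V. carrier (localization_at A p))"
        using t unfolding spec_sections_def by auto
      fix q assume q: "q \<in> V"
      let ?p = "contract q"
      have p: "?p \<in> ?U" and ep: "extend ?p = q" using cU[OF q] extend_contract[OF Vp[OF q]] by auto
      have "stalk_map ?p (t (extend ?p)) = stalk_map ?p (t' (extend ?p))"
        using fun_cong[OF e, of ?p] p by (simp add: section_map_def)
      then have "t (extend ?p) = t' (extend ?p)"
        using p st[OF t(1) p] st[OF t(2) p] by (intro stalk_map_inj[of ?p]) auto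
      then show "t q = t' q" unfolding ep .
    qed
  qed
  \<comment> \<open>The value at \<open>q\<close> of the preimage is the inverse of \<open>stalk_map\<close> applied to the value at \<open>contract q\<close>.\<close>
  have surj: "\<exists>t\<in>carrier (spec_sections A V). section_map V t = s" if s: "s \<in> carrier (spec_sections R ?U)" for s
  proof -
    have ex: "\<exists>C. C \<in> carrier (localization_at A (extend p)) \<and> stalk_map p C = s p" if p: "p \<in> ?U" for p
    proof -
      have pd: "p \<in> locus" using p by simp
      have "s p \<in> carrier (localization_at R p)" using s p unfolding spec_sections_def by auto
      then obtain a b where ab: "a \<in> carrier R" "b \<in> carrier R - p" "s p = frR p a b"
        using fractions.carrier_localizationE[OF fractions_R[OF pd]] by metis
      then show ?thesis using stalk_map_frac[OF pd ab(1,2)] phi_denominator[OF pd ab(2)]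
          fractions.cls_closed[OF fractions_A[OF pd] phi_closed[OF ab(1)]] by metis
    qed
    have "\<forall>p\<in>?U. \<exists>C. C \<in> carrier (localization_at A (extend p)) \<and> stalk_map p C = s p"
      by (rule ballI) (rule ex)
    from bchoice[OF this] obtain c where c: "\<And>p. p \<in> ?U \<Longrightarrow> c p \<in> carrier (localization_at A (extend p))"
      "\<And>p. p \<in> ?U \<Longrightarrow> stalk_map p (c p) = s p" by auto
    define t where "t = (\<lambda>q\<in>V. c (contract q))"
    have "t \<in> (\<Pi>\<^sub>E p\<in>V. carrier (localization_at A p))"
    proof
      fix q assume q: "q \<in> V"
      show "t q \<in> carrier (localization_at A q)"
        using c(1)[OF cU[OF q]] q extend_contract[OF Vp[OF q]] by (simp add: t_def)
    qed (simp add: t_def)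
    moreover have "\<exists>W. openin (zariski A) W \<and> q \<in> W \<and> W \<subseteq> V \<and>
         (\<exists>a\<in>carrier A. \<exists>f\<in>carrier A. \<forall>q\<in>W. f \<notin> q \<and> t q = frac_at A q a f)" if q: "q \<in> V" for q
    proof -
      obtain W r f where W: "openin (zariski R) W" "contract q \<in> W" "W \<subseteq> ?U" and rf: "r \<in> carrier R" "f \<in> carrier R"
        "\<And>p. p \<in> W \<Longrightarrow> f \<notin> p \<and> s p = frR p r f"
        using s cU[OF q] unfolding spec_sections_def by auto
      let ?W = "{q. primeideal q A \<and> contract q \<in> W}"
      have WV: "?W \<subseteq> V" using W(3) extend_contract by auto
      have "\<phi> f \<notin> q' \<and> t q' = frac_at A q' (\<phi> r) (\<phi> f)" if q': "q' \<in> ?W" for q'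
      proof -
        let ?p = "contract q'"
        have ep: "extend ?p = q'" using q' extend_contract by simp
        have p: "?p \<in> W" "?p \<in> ?U" "?p \<in> locus" "q' \<in> V" using q' W(3) WV by auto
        have fp: "f \<in> carrier R - ?p" using rf(2,3) p(1) by auto
        have "c ?p = frA ?p (\<phi> r) (\<phi> f)"
        proof (rule stalk_map_inj[OF p(3) c(1)[OF p(2)]])
          show "frA ?p (\<phi> r) (\<phi> f) \<in> carrier (localization_at A (extend ?p))"
            using fractions.cls_closed[OF fractions_A[OF p(3)]] rf(1) phi_denominator[OF p(3) fp] by simp
          show "stalk_map ?p (c ?p) = stalk_map ?p (frA ?p (\<phi> r) (\<phi> f))"
            unfolding stalk_map_frac[OF p(3) rf(1) fp] c(2)[OF p(2)] using rf(3)[OF p(1)] by simp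
        qed
        then show ?thesis using phi_denominator[OF p(3) fp] p(4) unfolding ep by (simp add: t_def)
      qed
      then show ?thesis using openA[OF W(1)] W(2,3) WV Vp[OF q] rf(1,2)
        by (intro exI[of _ ?W] conjI bexI[of _ "\<phi> r"] bexI[of _ "\<phi> f"]) auto
    qed
    ultimately have tc: "t \<in> carrier (spec_sections A V)" unfolding spec_sections_def by simp
    have "section_map V t = s"
    proof (rule PiE_ext)
      show "section_map V t \<in> (\<Pi>\<^sub>E p\<in>?U. carrier (localization_at R p))" "s \<in> (\<Pi>\<^sub>E p\<in>?U. carrier (localization_at R p))"
        using closed[OF tc] s unfolding spec_sections_def by auto
      fix p assume p: "p \<in> ?U"
      then show "section_map V t p = s p"
        using c(2)[OF p] contract_extend[of p] by (simp add: section_map_def t_def)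
    qed
    then show ?thesis using tc by blast
  qed
  have "section_map V \<in> ring_hom (spec_sections A V) (spec_sections R ?U)"
  proof (rule ring_hom_memI)
    fix t t' assume t: "t \<in> carrier (spec_sections A V)" "t' \<in> carrier (spec_sections A V)"
    show "section_map V t \<in> carrier (spec_sections R ?U)" by (rule closed[OF t(1)])
    have "stalk_map p (t (extend p) \<otimes>\<^bsub>localization_at A (extend p)\<^esub> t' (extend p)) =
        stalk_map p (t (extend p)) \<otimes>\<^bsub>localization_at R p\<^esub> stalk_map p (t' (extend p))" if "p \<in> ?U" for p
      using that st[OF t(1) that] st[OF t(2) that] by (intro stalk_map_hom) auto
    then show "section_map V (t \<otimes>\<^bsub>spec_sections A V\<^esub> t') =
        section_map V t \<otimes>\<^bsub>spec_sections R ?U\<^esub> section_map V t'"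
      unfolding section_map_def spec_sections_def by (auto intro!: restrict_ext)
    have "stalk_map p (t (extend p) \<oplus>\<^bsub>localization_at A (extend p)\<^esub> t' (extend p)) =
        stalk_map p (t (extend p)) \<oplus>\<^bsub>localization_at R p\<^esub> stalk_map p (t' (extend p))" if "p \<in> ?U" for p
      using that st[OF t(1) that] st[OF t(2) that] by (intro stalk_map_hom) auto
    then show "section_map V (t \<oplus>\<^bsub>spec_sections A V\<^esub> t') =
        section_map V t \<oplus>\<^bsub>spec_sections R ?U\<^esub> section_map V t'"
      unfolding section_map_def spec_sections_def by (auto intro!: restrict_ext)
  next
    show "section_map V \<one>\<^bsub>spec_sections A V\<^esub> = \<one>\<^bsub>spec_sections R ?U\<^esub>"
      unfolding section_map_def spec_sections_def using stalk_map_one by (auto intro!: restrict_ext)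
  qed
  moreover have "bij_betw (section_map V) (carrier (spec_sections A V)) (carrier (spec_sections R ?U))"
    unfolding bij_betw_def using inj closed surj by blast
  ultimately show ?thesis by (simp add: ring_iso_def)
qed

theorem Spec_iso:
  assumes locus: "openin (zariski R) locus"
  shows "ringed_space_iso (open_subspace (Spec R) locus) (Spec A) extend section_map"
proof -
  have ts: "topspace (underlying (open_subspace (Spec R) locus)) = locus"
    using openin_subset[OF locus] by (auto simp: open_subspace_def Spec_def)
  have "homeomorphic_map (underlying (open_subspace (Spec R) locus)) (underlying (Spec A)) extend"
    using homeomorphic_maps_imp_map[OF homeomorphic_extend[OF locus]] by (simp add: open_subspace_def Spec_def)
  moreover have "section_map W (restrict s W) = restrict (section_map V s) {p \<in> locus. extend p \<in> W}"
    if "W \<subseteq> V" for V W s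
    using that by (auto simp: section_map_def fun_eq_iff restrict_def)
  ultimately show ?thesis
    unfolding ringed_space_iso_def ts using section_map_iso[OF locus]
    by (simp add: open_subspace_def Spec_def)
qed

end

section \<open>Affine open sets form a basis\<close>

lemma ringed_space_isoD:
  assumes "ringed_space_iso X Y f h"
  shows "homeomorphic_map (underlying X) (underlying Y) f"
    and "\<And>V. openin (underlying Y) V \<Longrightarrow>
      h V \<in> ring_iso (sections Y V) (sections X {x \<in> topspace (underlying X). f x \<in> V})"
    and "\<And>V W s. openin (underlying Y) V \<Longrightarrow> openin (underlying Y) W \<Longrightarrow> W \<subseteq> V \<Longrightarrow>
      s \<in> carrier (sections Y V) \<Longrightarrow>
      h W (restriction Y V W s) = restriction X {x \<in> topspace (underlying X). f x \<in> V}
        {x \<in> topspace (underlying X). f x \<in> W} (h V s)"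
  using assms unfolding ringed_space_iso_def by auto

lemma ringed_space_iso_trans:
  assumes XY: "ringed_space_iso X Y f h" and YZ: "ringed_space_iso Y Z f' h'"
  shows "ringed_space_iso X Z (f' \<circ> f) (\<lambda>V. h {y \<in> topspace (underlying Y). f' y \<in> V} \<circ> h' V)"
proof -
  let ?pre = "\<lambda>V. {y \<in> topspace (underlying Y). f' y \<in> V}"
  let ?pre2 = "\<lambda>V. {x \<in> topspace (underlying X). f x \<in> V}"
  have fY: "f x \<in> topspace (underlying Y)" if "x \<in> topspace (underlying X)" for x
    using homeomorphic_imp_surjective_map[OF ringed_space_isoD(1)[OF XY]] that by blast
  have pre: "{x \<in> topspace (underlying X). (f' \<circ> f) x \<in> V} = ?pre2 (?pre V)" for V
    using fY by auto
  have opre: "openin (underlying Y) (?pre V)" if "openin (underlying Z) V" for V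
    using openin_continuous_map_preimage[OF homeomorphic_imp_continuous_map[OF ringed_space_isoD(1)[OF YZ]] that] .
  show ?thesis unfolding ringed_space_iso_def pre
  proof (intro conjI allI impI ballI)
    show "homeomorphic_map (underlying X) (underlying Z) (f' \<circ> f)"
      by (rule homeomorphic_map_compose[OF ringed_space_isoD(1)[OF XY] ringed_space_isoD(1)[OF YZ]])
    show "h (?pre V) \<circ> h' V \<in> ring_iso (sections Z V) (sections X (?pre2 (?pre V)))"
      if "openin (underlying Z) V" for V
      by (rule ring_iso_set_trans[OF ringed_space_isoD(2)[OF YZ that] ringed_space_isoD(2)[OF XY opre[OF that]]])
    fix V W s assume V: "openin (underlying Z) V" and W: "openin (underlying Z) W" and WV: "W \<subseteq> V"
      and s: "s \<in> carrier (sections Z V)"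
    have "h' V s \<in> carrier (sections Y (?pre V))"
      using ringed_space_isoD(2)[OF YZ V] s by (auto simp: ring_iso_def dest: ring_hom_closed)
    moreover have "?pre W \<subseteq> ?pre V" using WV by auto
    ultimately show "(h (?pre W) \<circ> h' W) (restriction Z V W s) =
        restriction X (?pre2 (?pre V)) (?pre2 (?pre W)) ((h (?pre V) \<circ> h' V) s)"
      using ringed_space_isoD(3)[OF YZ V W WV s] ringed_space_isoD(3)[OF XY opre[OF V] opre[OF W]] by simp
  qed
qed

lemma ringed_space_iso_open_subspace:
  assumes XY: "ringed_space_iso X Y f h" and D: "openin (underlying Y) D"
  shows "ringed_space_iso (open_subspace X {x \<in> topspace (underlying X). f x \<in> D}) (open_subspace Y D) f h"
proof -
  let ?U = "{x \<in> topspace (underlying X). f x \<in> D}"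
  have ts: "topspace (underlying (open_subspace X ?U)) = ?U" by (auto simp: open_subspace_def)
  have "homeomorphic_map (subtopology (underlying X) ?U) (subtopology (underlying Y) D) f"
    by (rule homeomorphic_map_subtopologies_alt[OF ringed_space_isoD(1)[OF XY]]) auto
  moreover have "{x \<in> ?U. f x \<in> V} = {x \<in> topspace (underlying X). f x \<in> V}" if "V \<subseteq> D" for V
    using that by auto
  ultimately show ?thesis using ringed_space_isoD(2,3)[OF XY]
    unfolding ringed_space_iso_def ts by (auto simp: open_subspace_def openin_open_subtopology[OF D])
qed

lemma open_subspace_twice: "U' \<subseteq> U \<Longrightarrow> open_subspace (open_subspace X U) U' = open_subspace X U'"
  by (simp add: open_subspace_def subtopology_subtopology Int_absorb1)

lemma ringed_spaceD:
  assumes "is_ringed_space X"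
  shows "openin (underlying X) U \<Longrightarrow> cring (sections X U)"
    and "openin (underlying X) U \<Longrightarrow> openin (underlying X) V \<Longrightarrow> V \<subseteq> U \<Longrightarrow>
      restriction X U V \<in> ring_hom (sections X U) (sections X V)"
    and "sheaf_of_sets (underlying X) (\<lambda>U. carrier (sections X U)) (restriction X)"
  using assms unfolding is_ringed_space_def by auto

lemma presheaf_of_setsD:
  assumes "presheaf_of_sets T F r"
  shows "openin T U \<Longrightarrow> openin T V \<Longrightarrow> V \<subseteq> U \<Longrightarrow> s \<in> F U \<Longrightarrow> r U V s \<in> F V"
    and "openin T U \<Longrightarrow> s \<in> F U \<Longrightarrow> r U U s = s"
    and "openin T U \<Longrightarrow> openin T V \<Longrightarrow> openin T W \<Longrightarrow> V \<subseteq> U \<Longrightarrow> W \<subseteq> V \<Longrightarrow> s \<in> F U \<Longrightarrow>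
      r V W (r U V s) = r U W s"
  using assms[unfolded presheaf_of_sets_def, THEN conjunct1, rule_format]
    assms[unfolded presheaf_of_sets_def, THEN conjunct2, THEN conjunct1, rule_format]
    assms[unfolded presheaf_of_sets_def, THEN conjunct2, THEN conjunct2, rule_format]
  by simp_all

lemma (in cring) fraction_one_ring_hom:
  assumes U: "openin (zariski R) U"
  shows "(\<lambda>r. \<lambda>q\<in>U. frac_at R q r \<one>) \<in> ring_hom R (spec_sections R U)"
proof (rule ring_hom_memI)
  have fr: "fractions R (carrier R - q)" if "q \<in> U" for q
    using fractions_prime[OF openin_zariski_prime[OF U that]] .
  show "(\<lambda>q\<in>U. frac_at R q r \<one>) \<in> carrier (spec_sections R U)" if "r \<in> carrier R" for r
  proof (rule const_section[OF U that one_closed])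
    show "\<one> \<notin> q" if "q \<in> U" for q using fractions.M_one[OF fr[OF that]] by simp
  qed
  fix r s assume rs: "r \<in> carrier R" "s \<in> carrier R"
  show "(\<lambda>q\<in>U. frac_at R q (r \<otimes> s) \<one>) =
      (\<lambda>q\<in>U. frac_at R q r \<one>) \<otimes>\<^bsub>spec_sections R U\<^esub> (\<lambda>q\<in>U. frac_at R q s \<one>)"
    unfolding spec_sections_def
    using fractions.mult_cls[OF fr rs(1) fractions.M_one[OF fr] rs(2) fractions.M_one[OF fr]]
    by (auto intro!: restrict_ext)
  show "(\<lambda>q\<in>U. frac_at R q (r \<oplus> s) \<one>) =
      (\<lambda>q\<in>U. frac_at R q r \<one>) \<oplus>\<^bsub>spec_sections R U\<^esub> (\<lambda>q\<in>U. frac_at R q s \<one>)"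
    unfolding spec_sections_def
    using fractions.add_cls[OF fr rs(1) fractions.M_one[OF fr] rs(2) fractions.M_one[OF fr]] rs
    by (auto intro!: restrict_ext)
next
  show "(\<lambda>q\<in>U. frac_at R q \<one> \<one>) = \<one>\<^bsub>spec_sections R U\<^esub>"
    unfolding spec_sections_def by (auto intro!: restrict_ext simp: localization_def)
qed

text \<open>By \<open>section_on_basic_open\<close> every section over \<open>D(g)\<close> has a power of \<open>g\<close> as denominator,
  and by \<open>vanishing_on_basic_open\<close> the elements of \<open>R\<close> that vanish on \<open>D(g)\<close> are killed by a power of
  \<open>g\<close>.\<close>

lemma (in cring) basic_open_localization:
  assumes g: "g \<in> carrier R" and A: "cring A"
    and \<eta>: "\<eta> \<in> ring_iso (spec_sections R (basic_open R g)) A"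
  shows "localization_map R (range (\<lambda>n::nat. g [^] n)) A (\<lambda>r. \<eta> (\<lambda>q\<in>basic_open R g. frac_at R q r \<one>))"
    (is "localization_map R ?M A ?\<phi>")
proof -
  let ?D = "basic_open R g" and ?S = "spec_sections R (basic_open R g)"
  let ?\<psi> = "\<lambda>r. \<lambda>q\<in>?D. frac_at R q r \<one>"
  interpret A: cring A by (rule A)
  have D: "openin (zariski R) ?D" by (rule openin_basic_open[OF g])
  have \<psi>: "?\<psi> \<in> ring_hom R ?S" by (rule fraction_one_ring_hom[OF D])
  have \<psi>c: "?\<psi> r \<in> carrier ?S" if "r \<in> carrier R" for r using ring_hom_closed[OF \<psi> that] .
  have \<eta>h: "\<eta> \<in> ring_hom ?S A" and \<eta>b: "bij_betw \<eta> (carrier ?S) (carrier A)"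
    using \<eta> by (auto simp: ring_iso_def)
  have fr: "fractions R (carrier R - q)" and pr: "primeideal q R" if "q \<in> ?D" for q
    using openin_zariski_prime[OF D that] fractions_prime by auto
  have gn: "g [^] (n::nat) \<in> carrier R - q" if "q \<in> ?D" for q n
    using primeideal.pow_mem_imp_mem[OF pr[OF that] g, of n] that g by (auto simp: basic_open_def)
  have frM: "fractions R ?M"
  proof
    show "\<one> \<in> ?M" by (rule range_eqI[of _ _ 0]) simp
    show "a \<otimes> b \<in> ?M" if "a \<in> ?M" "b \<in> ?M" for a b using that g by (auto simp: nat_pow_mult)
  qed (use g in auto)
  show ?thesis
  proof (rule localization_map.intro[OF frM A], unfold_locales)
    show "?\<phi> \<in> ring_hom R A" using ring_hom_trans[OF \<psi> \<eta>h] by (simp add: comp_def)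
    show "\<exists>a\<in>carrier A. a \<otimes>\<^bsub>A\<^esub> ?\<phi> m = \<one>\<^bsub>A\<^esub>" if mM: "m \<in> ?M" for m
    proof -
      obtain n where m: "m = g [^] (n::nat)" using mM by auto
      have mc: "m \<in> carrier R" using m g by simp
      let ?i = "\<lambda>q\<in>?D. frac_at R q \<one> m"
      have ic: "?i \<in> carrier ?S" using gn unfolding m by (intro const_section[OF D]) (use g in auto)
      have "frac_at R q \<one> m \<otimes>\<^bsub>localization_at R q\<^esub> frac_at R q m \<one> = \<one>\<^bsub>localization_at R q\<^esub>"
        if q: "q \<in> ?D" for q
      proof -
        interpret Lq: fractions R "carrier R - q" by (rule fr[OF q])
        have mq: "m \<in> carrier R - q" using gn[OF q, of n] m by simp
        have "Lq.cls (\<one> \<otimes> m) (m \<otimes> \<one>) = Lq.cls \<one> \<one>"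
          using mq mc Lq.M_one by (intro Lq.cls_eqI) simp_all
        then show ?thesis using Lq.mult_cls[OF one_closed mq mc Lq.M_one] Lq.one_cls by simp
      qed
      then have "?i \<otimes>\<^bsub>?S\<^esub> ?\<psi> m = \<one>\<^bsub>?S\<^esub>"
        unfolding spec_sections_def by (auto intro!: restrict_ext)
      then have "\<eta> ?i \<otimes>\<^bsub>A\<^esub> ?\<phi> m = \<one>\<^bsub>A\<^esub>"
        using ring_hom_mult[OF \<eta>h ic \<psi>c[OF mc]] ring_hom_one[OF \<eta>h] by simp
      then show ?thesis using ring_hom_closed[OF \<eta>h ic] by blast
    qed
    show "\<exists>m\<in>?M. \<exists>r\<in>carrier R. ?\<phi> m \<otimes>\<^bsub>A\<^esub> a = ?\<phi> r" if a: "a \<in> carrier A" for a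
    proof -
      obtain s where s: "s \<in> carrier ?S" "\<eta> s = a" using \<eta>b a unfolding bij_betw_def by (metis imageE)
      obtain n b where b: "b \<in> carrier R" and sq: "\<And>q. q \<in> ?D \<Longrightarrow> s q = frac_at R q b (g [^] (n::nat))"
        using section_on_basic_open[OF g s(1)] by auto
      let ?m = "g [^] n"
      have mc: "?m \<in> carrier R" using g by simp
      have "frac_at R q ?m \<one> \<otimes>\<^bsub>localization_at R q\<^esub> s q = frac_at R q b \<one>" if q: "q \<in> ?D" for q
      proof -
        interpret Lq: fractions R "carrier R - q" by (rule fr[OF q])
        have "Lq.cls (?m \<otimes> b) (\<one> \<otimes> ?m) = Lq.cls b \<one>"
          using gn[OF q, of n] mc b Lq.M_one by (intro Lq.cls_eqI) simp_all
        then show ?thesis unfolding sq[OF q] using Lq.mult_cls[OF mc Lq.M_one b gn[OF q, of n]] by simp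
      qed
      then have "?\<psi> ?m \<otimes>\<^bsub>?S\<^esub> s = ?\<psi> b"
        unfolding spec_sections_def by (auto intro!: restrict_ext)
      then have "?\<phi> ?m \<otimes>\<^bsub>A\<^esub> a = ?\<phi> b" using ring_hom_mult[OF \<eta>h \<psi>c[OF mc] s(1)] s(2) by simp
      then show ?thesis using b by blast
    qed
    show "\<exists>m\<in>?M. m \<otimes> r = m \<otimes> r'" if r: "r \<in> carrier R" "r' \<in> carrier R" and e: "?\<phi> r = ?\<phi> r'" for r r'
    proof -
      have e': "?\<psi> r = ?\<psi> r'"
        using \<eta>b e \<psi>c[OF r(1)] \<psi>c[OF r(2)] by (auto simp: bij_betw_def inj_on_def)
      have "\<exists>n::nat. g [^] n \<otimes> r = g [^] n \<otimes> r'"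
      proof (rule vanishing_on_basic_open[OF g r])
        fix q assume q: "q \<in> ?D"
        interpret Lq: fractions R "carrier R - q" by (rule fr[OF q])
        have "Lq.cls r \<one> = Lq.cls r' \<one>" using fun_cong[OF e', of q] q by simp
        then show "\<exists>u\<in>carrier R - q. u \<otimes> r = u \<otimes> r'"
          using Lq.cls_eq_iff[OF r(1) Lq.M_one r(2) Lq.M_one] r by simp
      qed
      then show ?thesis by auto
    qed
  qed
qed

text \<open>The ring over \<open>U'\<close> is the localization of \<open>R\<close> at \<open>g\<close>, so \<open>Spec_iso\<close> identifies its spectrum
  with the basic open subset \<open>D(g)\<close> of \<open>Spec R\<close>, which is \<open>U'\<close>. In the second part \<open>c\<close> and \<open>d\<close> come from
  mutually inverse powers of \<open>g\<close>: up to units, sections over \<open>U'\<close> are restrictions from \<open>U\<close>.\<close>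

lemma basic_open_affine:
  fixes X :: "('a, 'b) ringed_space" and R :: "'b ring"
  assumes X: "is_ringed_space X" and U: "openin (underlying X) U" and R: "cring R"
    and iso: "ringed_space_iso (open_subspace X U) (Spec R) f h" and g: "g \<in> carrier R"
  defines "U' \<equiv> {y \<in> U. f y \<in> basic_open R g}"
  shows "affine_open X U'"
    and "\<forall>a\<in>carrier (sections X U'). \<exists>r\<in>carrier (sections X U). \<exists>c\<in>carrier (sections X U').
      \<exists>d\<in>carrier (sections X U'). a = c \<otimes>\<^bsub>sections X U'\<^esub> restriction X U U' r \<and>
        restriction X U U' r = d \<otimes>\<^bsub>sections X U'\<^esub> a"
proof -
  interpret R: cring R by (rule R)
  let ?D = "basic_open R g" and ?A = "sections X U'"
  have ts: "topspace (underlying (open_subspace X U)) = U"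
    using openin_subset[OF U] by (auto simp: open_subspace_def)
  have sec: "sections (open_subspace X U) = sections X" "restriction (open_subspace X U) = restriction X"
    "sections (Spec R) = spec_sections R" "restriction (Spec R) = (\<lambda>U V s. restrict s V)"
    "underlying (Spec R) = zariski R"
    by (simp_all add: open_subspace_def Spec_def)
  note isoD = ringed_space_isoD[OF iso, unfolded ts sec]
  have D: "openin (zariski R) ?D" by (rule openin_basic_open[OF g])
  have U'o: "openin (underlying X) U'"
    using openin_continuous_map_preimage[OF homeomorphic_imp_continuous_map[OF isoD(1)] D]
      openin_trans_full[OF _ U] unfolding ts U'_def by (simp add: open_subspace_def)
  have A: "cring ?A" by (rule ringed_spaceD(1)[OF X U'o])
  let ?\<psi> = "\<lambda>r. \<lambda>q\<in>?D. frac_at R q r \<one>\<^bsub>R\<^esub>" and ?M = "range (\<lambda>n::nat. g [^]\<^bsub>R\<^esub> n)"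
  let ?\<phi> = "\<lambda>r. h ?D (?\<psi> r)"
  interpret L: localization_map R ?M ?A ?\<phi>
    using R.basic_open_localization[OF g A] isoD(2)[OF D] unfolding U'_def by blast
  have locus: "L.locus = ?D"
  proof -
    have "p \<inter> ?M = {} \<longleftrightarrow> g \<notin> p" if "primeideal p R" for p
      using primeideal.pow_mem_imp_mem[OF that g] R.nat_pow_eone[OF g] by (metis disjoint_iff imageE rangeI)
    then show ?thesis by (auto simp: L.locus_def basic_open_def)
  qed
  have "ringed_space_iso (open_subspace (Spec R) ?D) (Spec ?A) L.extend L.section_map"
    using L.Spec_iso D unfolding locus by blast
  moreover have "ringed_space_iso (open_subspace X U') (open_subspace (Spec R) ?D) f h"
    using ringed_space_iso_open_subspace[OF iso, of ?D] D open_subspace_twice[of U' U X]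
    unfolding ts sec U'_def by simp
  ultimately show "affine_open X U'"
    using ringed_space_iso_trans A U'o unfolding affine_open_def by blast
  show "\<forall>a\<in>carrier ?A. \<exists>r\<in>carrier (sections X U). \<exists>c\<in>carrier ?A. \<exists>d\<in>carrier ?A.
      a = c \<otimes>\<^bsub>?A\<^esub> restriction X U U' r \<and> restriction X U U' r = d \<otimes>\<^bsub>?A\<^esub> a"
  proof
    fix a assume a: "a \<in> carrier ?A"
    obtain m r where m: "m \<in> ?M" "r \<in> carrier R" "?\<phi> m \<otimes>\<^bsub>?A\<^esub> a = ?\<phi> r"
      using L.numerator[OF a] by blast
    obtain c where c: "c \<in> carrier ?A" "c \<otimes>\<^bsub>?A\<^esub> ?\<phi> m = \<one>\<^bsub>?A\<^esub>" using L.unit[OF m(1)] by blast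
    \<comment> \<open>The numerator \<open>r\<close> is a section on all of \<open>Spec R\<close>, so \<open>?\<phi> r\<close> is restricted from \<open>U\<close>.\<close>
    let ?T = "{p. primeideal p R}"
    have T: "openin (zariski R) ?T" using openin_topspace[of "zariski R"] by (simp add: topspace_zariski)
    have fT: "f y \<in> ?T" if "y \<in> U" for y
      using homeomorphic_imp_surjective_map[OF isoD(1)] that unfolding topspace_zariski ts by blast
    have UT: "{x \<in> U. f x \<in> ?T} = U" using fT by auto
    let ?s = "\<lambda>q\<in>?T. frac_at R q r \<one>\<^bsub>R\<^esub>"
    have s: "?s \<in> carrier (spec_sections R ?T)"
      using ring_hom_closed[OF R.fraction_one_ring_hom[OF T] m(2)] .
    have DT: "?D \<subseteq> ?T" by (auto simp: basic_open_def)
    have "restrict ?s ?D = ?\<psi> r" using DT by (auto simp: fun_eq_iff restrict_def)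
    then have res: "?\<phi> r = restriction X U U' (h ?T ?s)"
      using isoD(3)[OF T D DT s] unfolding UT U'_def by simp
    have hs: "h ?T ?s \<in> carrier (sections X U)"
      using isoD(2)[OF T] s unfolding UT by (auto simp: ring_iso_def dest: ring_hom_closed)
    have mc: "?\<phi> m \<in> carrier ?A" by (rule L.phi_closed[OF L.M_carr[OF m(1)]])
    have "c \<otimes>\<^bsub>?A\<^esub> ?\<phi> r = a" unfolding m(3)[symmetric]
      using c a mc by (simp flip: L.A.m_assoc)
    then show "\<exists>r\<in>carrier (sections X U). \<exists>c\<in>carrier ?A. \<exists>d\<in>carrier ?A.
      a = c \<otimes>\<^bsub>?A\<^esub> restriction X U U' r \<and> restriction X U U' r = d \<otimes>\<^bsub>?A\<^esub> a"
      using hs c(1) mc m(3) unfolding res by metis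
  qed
qed

lemma affine_neighbourhood:
  assumes X: "is_ringed_space X" and U: "affine_open X U" and W: "openin (underlying X) W"
    and x: "x \<in> U" "x \<in> W"
  obtains U' where "affine_open X U'" "x \<in> U'" "U' \<subseteq> U" "U' \<subseteq> W"
    "\<forall>a\<in>carrier (sections X U'). \<exists>r\<in>carrier (sections X U). \<exists>c\<in>carrier (sections X U').
      \<exists>d\<in>carrier (sections X U'). a = c \<otimes>\<^bsub>sections X U'\<^esub> restriction X U U' r \<and>
        restriction X U U' r = d \<otimes>\<^bsub>sections X U'\<^esub> a"
proof -
  obtain R :: "'b ring" and f h where R: "cring R" and iso: "ringed_space_iso (open_subspace X U) (Spec R) f h"
    and Uo: "openin (underlying X) U" using U unfolding affine_open_def by blast
  have ts: "topspace (subtopology (underlying X) U) = U" using openin_subset[OF Uo] by auto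
  have hm: "homeomorphic_map (subtopology (underlying X) U) (zariski R) f"
    using ringed_space_isoD(1)[OF iso] by (simp add: open_subspace_def Spec_def)
  have "openin (subtopology (underlying X) U) (U \<inter> W)"
    using W Uo by (simp add: openin_open_subtopology openin_Int)
  then have "openin (zariski R) (f ` (U \<inter> W))"
    using homeomorphic_map_openness_eq[OF hm] by blast
  then obtain g where g: "g \<in> carrier R" "f x \<in> basic_open R g" "basic_open R g \<subseteq> f ` (U \<inter> W)"
    using x by (elim zariski_basis[of _ _ "f x"]) auto
  have inj: "inj_on f U" using hm unfolding homeomorphic_map_def ts by blast
  have "{y \<in> U. f y \<in> basic_open R g} \<subseteq> W"
  proof
    fix y assume y: "y \<in> {y \<in> U. f y \<in> basic_open R g}"
    then obtain z where "z \<in> U \<inter> W" "f y = f z" using g(3) by blast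
    then show "y \<in> W" using y inj_onD[OF inj, of y z] by auto
  qed
  then show thesis
    using basic_open_affine[OF X Uo R iso g(1)] g(2) x by (intro that) auto
qed

text \<open>An ideal of \<open>S\<close> is generated by the image of its preimage.\<close>

lemma noetherian_ring_fractions:
  assumes R: "noetherian_ring R" and S: "cring S" and h: "h \<in> ring_hom R S"
    and frac: "\<forall>a\<in>carrier S. \<exists>r\<in>carrier R. \<exists>c\<in>carrier S. \<exists>d\<in>carrier S.
      a = c \<otimes>\<^bsub>S\<^esub> h r \<and> h r = d \<otimes>\<^bsub>S\<^esub> a"
  shows "noetherian_ring S"
proof -
  interpret R: noetherian_ring R by (rule R)
  interpret S: cring S by (rule S)
  interpret h: ring_hom_ring R S h by (rule ring_hom_ringI2[OF R.ring_axioms S.ring_axioms h])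
  show ?thesis
  proof
    fix J assume J: "ideal J S"
    have Jsub: "J \<subseteq> carrier S" using ideal.Icarr[OF J] by auto
    obtain F where F: "F \<subseteq> carrier R" "finite F" "{r \<in> carrier R. h r \<in> J} = genideal R F"
      using R.finetely_gen[OF h.ideal_vimage[OF J]] by blast
    have hF: "h ` F \<subseteq> carrier S" using F(1) by auto
    have K: "ideal (genideal S (h ` F)) S" by (rule S.genideal_ideal[OF hF])
    have "h ` F \<subseteq> J" using R.genideal_self[OF F(1)] F(3) by auto
    then have "genideal S (h ` F) \<subseteq> J" by (rule S.genideal_minimal[OF J])
    moreover have "J \<subseteq> genideal S (h ` F)"
    proof
      fix a assume a: "a \<in> J"
      then obtain r c d where r: "r \<in> carrier R" "c \<in> carrier S" "d \<in> carrier S"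
        "a = c \<otimes>\<^bsub>S\<^esub> h r" "h r = d \<otimes>\<^bsub>S\<^esub> a" using frac Jsub by blast
      have "h r \<in> J" unfolding r(5) by (rule ideal.I_l_closed[OF J a r(3)])
      then have "r \<in> genideal R F" using r(1) F(3) by auto
      moreover have "F \<subseteq> {r \<in> carrier R. h r \<in> genideal S (h ` F)}"
        using F(1) S.genideal_self[OF hF] by auto
      then have "genideal R F \<subseteq> {r \<in> carrier R. h r \<in> genideal S (h ` F)}"
        by (rule R.genideal_minimal[OF h.ideal_vimage[OF K]])
      ultimately have "h r \<in> genideal S (h ` F)" by blast
      then show "a \<in> genideal S (h ` F)" unfolding r(4) by (rule ideal.I_l_closed[OF K _ r(2)])
    qed
    ultimately show "\<exists>A\<subseteq>carrier S. finite A \<and> J = genideal S A"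
      using hF F(2) by (intro exI[of _ "h ` F"]) auto
  qed
qed

section \<open>Closures of ideal sheaves\<close>

locale scheme_preclosure =
  fixes X :: "('a, 'b) ringed_space" and cl :: "'a set \<Rightarrow> 'b set \<Rightarrow> 'b set"
  assumes scheme: "is_scheme X" and preclosure: "ideals_preclosure X cl"
    and persistent: "openly_persistent X cl"
begin

abbreviation opn where "opn \<equiv> openin (underlying X)"
abbreviation \<O> where "\<O> \<equiv> sections X"
abbreviation res where "res \<equiv> restriction X"

lemma ringed: "is_ringed_space X"
  using scheme by (simp add: is_scheme_def locally_ringed_space_def)

lemma affine_open: "affine_open X U \<Longrightarrow> opn U"
  by (simp add: affine_open_def)

lemma cring: "opn U \<Longrightarrow> cring (\<O> U)"
  by (rule ringed_spaceD(1)[OF ringed])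

lemma res_hom: "opn U \<Longrightarrow> opn V \<Longrightarrow> V \<subseteq> U \<Longrightarrow> res U V \<in> ring_hom (\<O> U) (\<O> V)"
  by (rule ringed_spaceD(2)[OF ringed])

lemma res_closed: "opn U \<Longrightarrow> opn V \<Longrightarrow> V \<subseteq> U \<Longrightarrow> s \<in> carrier (\<O> U) \<Longrightarrow> res U V s \<in> carrier (\<O> V)"
  by (rule ring_hom_closed[OF res_hom])

lemma res_ring_hom: "opn U \<Longrightarrow> opn V \<Longrightarrow> V \<subseteq> U \<Longrightarrow> ring_hom_ring (\<O> U) (\<O> V) (res U V)"
  by (rule ring_hom_ringI2) (auto intro: res_hom cring.axioms(1) cring)

lemma presheaf: "presheaf_of_sets (underlying X) (\<lambda>U. carrier (\<O> U)) res"
  using ringed_spaceD(3)[OF ringed] by (simp add: sheaf_of_sets_def)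

lemma res_res:
  "opn U \<Longrightarrow> opn V \<Longrightarrow> opn W \<Longrightarrow> V \<subseteq> U \<Longrightarrow> W \<subseteq> V \<Longrightarrow> s \<in> carrier (\<O> U) \<Longrightarrow>
    res V W (res U V s) = res U W s"
  by (rule presheaf_of_setsD(3)[OF presheaf])

lemma affine_basis:
  assumes "opn W" "x \<in> W"
  obtains V where "affine_open X V" "x \<in> V" "V \<subseteq> W"
proof -
  have "x \<in> topspace (underlying X)" using openin_subset assms by blast
  then obtain U where "affine_open X U" "x \<in> U" using scheme by (auto simp: is_scheme_def)
  then show thesis using affine_neighbourhood[OF ringed _ assms(1) _ assms(2)] that by metis
qed

lemma cl_ideal: "affine_open X U \<Longrightarrow> ideal J (\<O> U) \<Longrightarrow> ideal (cl U J) (\<O> U)"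
  and cl_extensive: "affine_open X U \<Longrightarrow> ideal J (\<O> U) \<Longrightarrow> J \<subseteq> cl U J"
  and cl_mono: "affine_open X U \<Longrightarrow> ideal J (\<O> U) \<Longrightarrow> ideal K (\<O> U) \<Longrightarrow> J \<subseteq> K \<Longrightarrow> cl U J \<subseteq> cl U K"
  using preclosure unfolding ideals_preclosure_def preclosure_on_def by auto

text \<open>Persistence combined with monotonicity. It is used in this form with \<open>K\<close> larger than the
  extension of \<open>J\<close>, in particular with values of one ideal sheaf and, for idempotence, with \<open>K\<close>
  itself a closure.\<close>

lemma res_cl:
  assumes U: "affine_open X U" and V: "affine_open X V" and VU: "V \<subseteq> U"
    and J: "ideal J (\<O> U)" and K: "ideal K (\<O> V)" and JK: "res U V ` J \<subseteq> K" and s: "s \<in> cl U J"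
  shows "res U V s \<in> cl V K"
proof -
  interpret V: cring "\<O> V" by (rule cring[OF affine_open[OF V]])
  have sub: "res U V ` J \<subseteq> carrier (\<O> V)" using JK ideal.Icarr[OF K] by blast
  have "res U V s \<in> cl V (genideal (\<O> V) (res U V ` J))"
    using persistent U V VU J s unfolding openly_persistent_def by blast
  moreover have "cl V (genideal (\<O> V) (res U V ` J)) \<subseteq> cl V K"
    by (rule cl_mono[OF V V.genideal_ideal[OF sub] K V.genideal_minimal[OF K JK]])
  ultimately show ?thesis by blast
qed

context
  fixes I assumes I: "ideal_sheaf X I"
begin

lemma sheaf_ideal: "opn U \<Longrightarrow> ideal (I U) (\<O> U)"
  using I by (simp add: ideal_sheaf_def)

lemma sheaf_res: "opn U \<Longrightarrow> opn V \<Longrightarrow> V \<subseteq> U \<Longrightarrow> res U V ` I U \<subseteq> I V"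
  using presheaf_of_setsD(1)[of "underlying X" I res U V] I
  by (auto simp: ideal_sheaf_def sheaf_of_sets_def)

lemma cl_shrink:
  assumes "affine_open X U" "affine_open X V" "V \<subseteq> U" "s \<in> cl U (I U)"
  shows "res U V s \<in> cl V (I V)"
  using assms affine_open by (intro res_cl[OF assms(1-3) sheaf_ideal sheaf_ideal sheaf_res]) auto

text \<open>The condition defining \<open>sheaf_cl\<close> is inherited by smaller affine sets. Hence conditions
  for several sections, or several open sets, can be met on one affine neighbourhood.\<close>

lemma sheaf_clE:
  assumes U: "opn U" and s: "s \<in> sheaf_cl X cl I U" and x: "x \<in> U" and W: "opn W" "x \<in> W"
  obtains V where "affine_open X V" "x \<in> V" "V \<subseteq> U" "V \<subseteq> W"
    "\<And>V'. affine_open X V' \<Longrightarrow> V' \<subseteq> V \<Longrightarrow> res U V' s \<in> cl V' (I V')"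
proof -
  obtain V where V: "affine_open X V" "x \<in> V" "V \<subseteq> U" "res U V s \<in> cl V (I V)"
    and sc: "s \<in> carrier (\<O> U)" using s x by (auto simp: sheaf_cl_def)
  obtain V1 where V1: "affine_open X V1" "x \<in> V1" "V1 \<subseteq> V \<inter> W"
    by (rule affine_basis[of "V \<inter> W" x]) (use V W affine_open in auto)
  have "res U V' s \<in> cl V' (I V')" if V': "affine_open X V'" "V' \<subseteq> V1" for V'
  proof -
    have "V' \<subseteq> V" using V' V1 by blast
    then show ?thesis using cl_shrink[OF V(1) V'(1) _ V(4)]
        res_res[OF U affine_open[OF V(1)] affine_open[OF V'(1)] V(3) _ sc] by simp
  qed
  then show thesis using V V1 by (intro that[of V1]) auto
qed

lemma sheaf_clI:
  assumes "s \<in> carrier (\<O> U)"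
    and "\<And>x. x \<in> U \<Longrightarrow> \<exists>V. affine_open X V \<and> x \<in> V \<and> V \<subseteq> U \<and> res U V s \<in> cl V (I V)"
  shows "s \<in> sheaf_cl X cl I U"
  using assms by (simp add: sheaf_cl_def)

lemma sheaf_cl_iff_cover:
  assumes s: "s \<in> carrier (\<O> U)"
  shows "s \<in> sheaf_cl X cl I U \<longleftrightarrow> (\<exists>C. (\<forall>V\<in>C. affine_open X V \<and> V \<subseteq> U) \<and> U = \<Union>C \<and>
    (\<forall>V\<in>C. res U V s \<in> cl V (I V)))"
proof
  assume s: "s \<in> sheaf_cl X cl I U"
  let ?C = "{V. affine_open X V \<and> V \<subseteq> U \<and> res U V s \<in> cl V (I V)}"
  have "U = \<Union>?C" using s by (auto simp: sheaf_cl_def)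
  then show "\<exists>C. (\<forall>V\<in>C. affine_open X V \<and> V \<subseteq> U) \<and> U = \<Union>C \<and> (\<forall>V\<in>C. res U V s \<in> cl V (I V))"
    by (intro exI[of _ ?C]) auto
next
  assume "\<exists>C. (\<forall>V\<in>C. affine_open X V \<and> V \<subseteq> U) \<and> U = \<Union>C \<and> (\<forall>V\<in>C. res U V s \<in> cl V (I V))"
  then show "s \<in> sheaf_cl X cl I U" using s unfolding sheaf_cl_def by blast
qed

lemma subset_sheaf_cl:
  assumes U: "opn U" shows "I U \<subseteq> sheaf_cl X cl I U"
proof
  fix s assume s: "s \<in> I U"
  show "s \<in> sheaf_cl X cl I U"
  proof (rule sheaf_clI)
    show "s \<in> carrier (\<O> U)" using ideal.Icarr[OF sheaf_ideal[OF U] s] .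
    fix x assume "x \<in> U"
    then obtain V where V: "affine_open X V" "x \<in> V" "V \<subseteq> U" by (rule affine_basis[OF U])
    note Vo = affine_open[OF V(1)]
    have "res U V s \<in> I V" using sheaf_res[OF U Vo V(3)] s by blast
    then have "res U V s \<in> cl V (I V)" using cl_extensive[OF V(1) sheaf_ideal[OF Vo]] by blast
    then show "\<exists>V. affine_open X V \<and> x \<in> V \<and> V \<subseteq> U \<and> res U V s \<in> cl V (I V)" using V by blast
  qed
qed

lemma sheaf_cl_ideal:
  assumes U: "opn U" shows "ideal (sheaf_cl X cl I U) (\<O> U)"
proof -
  interpret U: cring "\<O> U" by (rule cring[OF U])
  show ?thesis
  proof (rule U.ideal_closedI)
    show "sheaf_cl X cl I U \<subseteq> carrier (\<O> U)" by (auto simp: sheaf_cl_def)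
    have "\<zero>\<^bsub>\<O> U\<^esub> \<in> I U" 
      by (rule additive_subgroup.zero_closed[OF ideal.axioms(1)[OF sheaf_ideal[OF U]]])
    then show "\<zero>\<^bsub>\<O> U\<^esub> \<in> sheaf_cl X cl I U" using subset_sheaf_cl[OF U] by blast
    fix s assume s: "s \<in> sheaf_cl X cl I U"
    then have sc: "s \<in> carrier (\<O> U)" by (simp add: sheaf_cl_def)
    show "s \<oplus>\<^bsub>\<O> U\<^esub> t \<in> sheaf_cl X cl I U" if t: "t \<in> sheaf_cl X cl I U" for t
    proof (rule sheaf_clI)
      have tc: "t \<in> carrier (\<O> U)" using t by (simp add: sheaf_cl_def)
      then show "s \<oplus>\<^bsub>\<O> U\<^esub> t \<in> carrier (\<O> U)" using sc by simp
      fix x assume x: "x \<in> U"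
      obtain V where V: "affine_open X V" "x \<in> V" "V \<subseteq> U"
        "\<And>V'. affine_open X V' \<Longrightarrow> V' \<subseteq> V \<Longrightarrow> res U V' s \<in> cl V' (I V')"
        by (rule sheaf_clE[OF U s x U x]) (rule that)
      obtain W where W: "affine_open X W" "x \<in> W" "W \<subseteq> U" "W \<subseteq> V"
        "\<And>V'. affine_open X V' \<Longrightarrow> V' \<subseteq> W \<Longrightarrow> res U V' t \<in> cl V' (I V')"
        by (rule sheaf_clE[OF U t x affine_open[OF V(1)] V(2)]) (rule that)
      note Wo = affine_open[OF W(1)]
      have "res U W s \<in> cl W (I W)" "res U W t \<in> cl W (I W)" using V(4) W by auto
      then have "res U W s \<oplus>\<^bsub>\<O> W\<^esub> res U W t \<in> cl W (I W)"
        by (rule additive_subgroup.a_closed[OF ideal.axioms(1)[OF cl_ideal[OF W(1) sheaf_ideal[OF Wo]]]])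
      then show "\<exists>V. affine_open X V \<and> x \<in> V \<and> V \<subseteq> U \<and> res U V (s \<oplus>\<^bsub>\<O> U\<^esub> t) \<in> cl V (I V)"
        using W(1-3) ring_hom_add[OF res_hom[OF U Wo W(3)] sc tc] by auto
    qed
    show "r \<otimes>\<^bsub>\<O> U\<^esub> s \<in> sheaf_cl X cl I U" if r: "r \<in> carrier (\<O> U)" for r
    proof (rule sheaf_clI)
      show "r \<otimes>\<^bsub>\<O> U\<^esub> s \<in> carrier (\<O> U)" using r sc by simp
      fix x assume x: "x \<in> U"
      obtain V where V: "affine_open X V" "x \<in> V" "V \<subseteq> U" "res U V s \<in> cl V (I V)"
        using s x by (auto simp: sheaf_cl_def)
      note Vo = affine_open[OF V(1)]
      have "res U V r \<otimes>\<^bsub>\<O> V\<^esub> res U V s \<in> cl V (I V)"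
        by (rule ideal.I_l_closed[OF cl_ideal[OF V(1) sheaf_ideal[OF Vo]] V(4) res_closed[OF U Vo V(3) r]])
      then show "\<exists>V. affine_open X V \<and> x \<in> V \<and> V \<subseteq> U \<and> res U V (r \<otimes>\<^bsub>\<O> U\<^esub> s) \<in> cl V (I V)"
        using V(1-3) ring_hom_mult[OF res_hom[OF U Vo V(3)] r sc] by auto
    qed
  qed
qed

lemma sheaf_cl_res:
  assumes U: "opn U" and W: "opn W" and WU: "W \<subseteq> U" and s: "s \<in> sheaf_cl X cl I U"
  shows "res U W s \<in> sheaf_cl X cl I W"
proof (rule sheaf_clI)
  have sc: "s \<in> carrier (\<O> U)" using s by (simp add: sheaf_cl_def)
  show "res U W s \<in> carrier (\<O> W)" by (rule res_closed[OF U W WU sc])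
  fix x assume x: "x \<in> W"
  then have "x \<in> U" using WU by blast
  then obtain V where V: "affine_open X V" "x \<in> V" "V \<subseteq> W"
    "\<And>V'. affine_open X V' \<Longrightarrow> V' \<subseteq> V \<Longrightarrow> res U V' s \<in> cl V' (I V')"
    using sheaf_clE[OF U s _ W x] by metis
  have "res W V (res U W s) = res U V s" by (rule res_res[OF U W affine_open[OF V(1)] WU V(3) sc])
  then show "\<exists>V. affine_open X V \<and> x \<in> V \<and> V \<subseteq> W \<and> res W V (res U W s) \<in> cl V (I V)"
    using V(1-3) V(4)[OF V(1)] by auto
qed

lemma sheaf_cl_local:
  assumes C: "\<And>V. V \<in> C \<Longrightarrow> opn V" and sc: "s \<in> carrier (\<O> (\<Union>C))"
    and loc: "\<And>V. V \<in> C \<Longrightarrow> res (\<Union>C) V s \<in> sheaf_cl X cl I V"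
  shows "s \<in> sheaf_cl X cl I (\<Union>C)"
proof (rule sheaf_clI[OF sc])
  fix x assume "x \<in> \<Union>C"
  then obtain W where W: "W \<in> C" "x \<in> W" by blast
  obtain V where V: "affine_open X V" "x \<in> V" "V \<subseteq> W" "res W V (res (\<Union>C) W s) \<in> cl V (I V)"
    using loc[OF W(1)] W(2) by (auto simp: sheaf_cl_def)
  have "res W V (res (\<Union>C) W s) = res (\<Union>C) V s"
    by (rule res_res[OF _ C[OF W(1)] affine_open[OF V(1)] _ V(3) sc]) (use C W in auto)
  then show "\<exists>V. affine_open X V \<and> x \<in> V \<and> V \<subseteq> \<Union>C \<and> res (\<Union>C) V s \<in> cl V (I V)"
    using V W(1) by (intro exI[of _ V]) auto
qed

theorem ideal_sheaf_sheaf_cl: "ideal_sheaf X (sheaf_cl X cl I)"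
  unfolding ideal_sheaf_def sheaf_of_sets_def
proof (intro conjI allI impI)
  show "ideal (sheaf_cl X cl I U) (\<O> U)" if "opn U" for U by (rule sheaf_cl_ideal[OF that])
  have sub: "s \<in> carrier (\<O> U)" if "s \<in> sheaf_cl X cl I U" for s U using that by (simp add: sheaf_cl_def)
  show "presheaf_of_sets (underlying X) (sheaf_cl X cl I) res"
    unfolding presheaf_of_sets_def
  proof (intro conjI allI impI ballI)
    show "res U V s \<in> sheaf_cl X cl I V"
      if "opn U" "opn V" "V \<subseteq> U" "s \<in> sheaf_cl X cl I U" for U V s by (rule sheaf_cl_res[OF that])
    show "res U U s = s" if "opn U" "s \<in> sheaf_cl X cl I U" for U s
      by (rule presheaf_of_setsD(2)[OF presheaf that(1) sub[OF that(2)]])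
    show "res V W (res U V s) = res U W s"
      if "opn U" "opn V" "opn W" "V \<subseteq> U" "W \<subseteq> V" "s \<in> sheaf_cl X cl I U" for U V W s
      by (rule res_res[OF that(1-5) sub[OF that(6)]])
  qed
  fix C t assume t: "\<forall>V\<in>C. opn V \<and> t V \<in> sheaf_cl X cl I V"
    and agree: "\<forall>V\<in>C. \<forall>W\<in>C. res V (V \<inter> W) (t V) = res W (V \<inter> W) (t W)"
  have "\<forall>V\<in>C. opn V \<and> t V \<in> carrier (\<O> V)" using t sub by blast
  from mp[OF mp[OF spec[OF spec[OF conjunct2[OF ringed_spaceD(3)[OF ringed, unfolded sheaf_of_sets_def]]]] this] agree]
  obtain s where s: "s \<in> carrier (\<O> (\<Union>C)) \<and> (\<forall>V\<in>C. res (\<Union>C) V s = t V)"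
    and uniq: "\<forall>s'. s' \<in> carrier (\<O> (\<Union>C)) \<and> (\<forall>V\<in>C. res (\<Union>C) V s' = t V) \<longrightarrow> s' = s"
    by (rule ex1E)
  show "\<exists>!s. s \<in> sheaf_cl X cl I (\<Union>C) \<and> (\<forall>V\<in>C. res (\<Union>C) V s = t V)"
  proof (rule ex1I[of _ s])
    have "s \<in> sheaf_cl X cl I (\<Union>C)" using t s by (intro sheaf_cl_local) auto
    then show "s \<in> sheaf_cl X cl I (\<Union>C) \<and> (\<forall>V\<in>C. res (\<Union>C) V s = t V)" using s by simp
    fix s' assume "s' \<in> sheaf_cl X cl I (\<Union>C) \<and> (\<forall>V\<in>C. res (\<Union>C) V s' = t V)"
    then show "s' = s" using uniq sub[of s' "\<Union>C"] by simp
  qed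
qed

end

lemma sheaf_cl_mono:
  assumes J: "ideal_sheaf X J" and I: "ideal_sheaf X I" and JI: "subsheaf X J I"
  shows "subsheaf X (sheaf_cl X cl J) (sheaf_cl X cl I)"
proof -
  have "cl V (J V) \<subseteq> cl V (I V)" if "affine_open X V" for V
    using affine_open[OF that] JI unfolding subsheaf_def
    by (intro cl_mono[OF that] sheaf_ideal[OF J] sheaf_ideal[OF I]) auto
  then show ?thesis unfolding subsheaf_def sheaf_cl_def by blast
qed

text \<open>Finiteness of \<open>F\<close> is essential: the sections need different affine neighbourhoods of \<open>x\<close>, and
  an infinite intersection of those need not be a neighbourhood. This is the reason for the Noetherian
  hypothesis in the idempotence statement.\<close>

lemma common_affine_neighbourhood:
  assumes I: "ideal_sheaf X I" and U: "opn U" "x \<in> U" and F: "finite F" "F \<subseteq> sheaf_cl X cl I U"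
  obtains W where "affine_open X W" "x \<in> W" "W \<subseteq> U" "\<And>s. s \<in> F \<Longrightarrow> res U W s \<in> cl W (I W)"
proof -
  have "\<forall>s\<in>F. \<exists>V. affine_open X V \<and> x \<in> V \<and> V \<subseteq> U \<and> res U V s \<in> cl V (I V)"
    using F(2) U(2) by (auto simp: sheaf_cl_def)
  then obtain V where V: "\<And>s. s \<in> F \<Longrightarrow> affine_open X (V s) \<and> x \<in> V s \<and> V s \<subseteq> U \<and> res U (V s) s \<in> cl (V s) (I (V s))"
    by metis
  have "opn (\<Inter>(insert U (V ` F)))"
    using F(1) U(1) V affine_open by (intro openin_Inter) auto
  moreover have "x \<in> \<Inter>(insert U (V ` F))" using U(2) V by auto
  ultimately obtain W where W: "affine_open X W" "x \<in> W" "W \<subseteq> \<Inter>(insert U (V ` F))"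
    by (rule affine_basis)
  have "res U W s \<in> cl W (I W)" if s: "s \<in> F" for s
  proof -
    have WV: "W \<subseteq> V s" using W(3) s by blast
    have sc: "s \<in> carrier (\<O> U)" using F(2) s by (auto simp: sheaf_cl_def)
    have "res (V s) W (res U (V s) s) = res U W s"
      using V[OF s] W(1) WV affine_open by (intro res_res[OF U(1) _ _ _ _ sc]) auto
    then show ?thesis using cl_shrink[OF I _ W(1) WV, of "res U (V s) s"] V[OF s] by simp
  qed
  then show thesis using W by (intro that[of W]) auto
qed

lemma noetherian_affine_neighbourhood:
  assumes X: "noetherian_scheme X" and W: "opn W" "x \<in> W"
  obtains V where "affine_open X V" "x \<in> V" "V \<subseteq> W" "noetherian_ring (\<O> V)"
proof -
  obtain C where C: "\<forall>U\<in>C. affine_open X U \<and> noetherian_ring (\<O> U)" "\<Union>C = topspace (underlying X)"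
    using X unfolding noetherian_scheme_def by blast
  then obtain U where U: "affine_open X U" "noetherian_ring (\<O> U)" "x \<in> U"
    using openin_subset[OF W(1)] W(2) by blast
  obtain V where V: "affine_open X V" "x \<in> V" "V \<subseteq> U" "V \<subseteq> W"
    and frac: "\<forall>a\<in>carrier (\<O> V). \<exists>r\<in>carrier (\<O> U). \<exists>c\<in>carrier (\<O> V).
      \<exists>d\<in>carrier (\<O> V). a = c \<otimes>\<^bsub>\<O> V\<^esub> res U V r \<and> res U V r = d \<otimes>\<^bsub>\<O> V\<^esub> a"
    by (rule affine_neighbourhood[OF ringed U(1) W(1) U(3) W(2)])
  note o = affine_open[OF U(1)] affine_open[OF V(1)]
  have "noetherian_ring (\<O> V)"
    by (rule noetherian_ring_fractions[OF U(2) cring[OF o(2)] res_hom[OF o V(3)] frac])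
  then show thesis using V by (intro that[of V]) auto
qed

text \<open>Near \<open>x\<close> let \<open>s|\<^sub>V\<close> lie in the closure of \<open>J(V)\<close>, where \<open>J\<close> is the closure of the sheaf \<open>I\<close>
  and \<open>V\<close> is a Noetherian affine neighbourhood. Finitely many generators of \<open>J(V)\<close> lie in the closure
  of \<open>I(W)\<close> on a common smaller affine \<open>W\<close>, so \<open>J(V)\<close> restricts into that closure. By persistence \<open>s|\<^sub>W\<close>
  lies in the closure of the closure of \<open>I(W)\<close>, which is the closure of \<open>I(W)\<close>.\<close>

theorem sheaf_cl_idem:
  assumes N: "noetherian_scheme X" and cl: "ideals_closure X cl"
    and I: "ideal_sheaf X I" and U: "opn U"
  shows "sheaf_cl X cl (sheaf_cl X cl I) U = sheaf_cl X cl I U"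
proof
  let ?J = "sheaf_cl X cl I"
  have J: "ideal_sheaf X ?J" by (rule ideal_sheaf_sheaf_cl[OF I])
  show "?J U \<subseteq> sheaf_cl X cl ?J U" by (rule subset_sheaf_cl[OF J U])
  show "sheaf_cl X cl ?J U \<subseteq> ?J U"
  proof
    fix s assume s: "s \<in> sheaf_cl X cl ?J U"
    have sc: "s \<in> carrier (\<O> U)" using s by (simp add: sheaf_cl_def)
    show "s \<in> ?J U"
    proof (rule sheaf_clI[OF I sc])
      fix x assume x: "x \<in> U"
      obtain V0 where V0: "affine_open X V0" "x \<in> V0" "V0 \<subseteq> U"
        "\<And>V'. affine_open X V' \<Longrightarrow> V' \<subseteq> V0 \<Longrightarrow> res U V' s \<in> cl V' (?J V')"
        by (rule sheaf_clE[OF J U s x U x]) (rule that)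
      obtain V where V: "affine_open X V" "x \<in> V" "V \<subseteq> V0" "noetherian_ring (\<O> V)"
        by (rule noetherian_affine_neighbourhood[OF N affine_open[OF V0(1)] V0(2)])
      have VU: "V \<subseteq> U" using V(3) V0(3) by blast
      note Vo = affine_open[OF V(1)]
      have sV: "res U V s \<in> cl V (?J V)" by (rule V0(4)[OF V(1,3)])
      interpret OV: noetherian_ring "\<O> V" by (rule V(4))
      obtain F where F: "F \<subseteq> carrier (\<O> V)" "finite F" "?J V = genideal (\<O> V) F"
        using OV.finetely_gen[OF sheaf_ideal[OF J Vo]] by blast
      have FJ: "F \<subseteq> ?J V" unfolding F(3) by (rule OV.genideal_self[OF F(1)])
      obtain W where W: "affine_open X W" "x \<in> W" "W \<subseteq> V" "\<And>r. r \<in> F \<Longrightarrow> res V W r \<in> cl W (I W)"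
        by (rule common_affine_neighbourhood[OF I Vo V(2) F(2) FJ]) (rule that)
      note Wo = affine_open[OF W(1)]
      have IW: "ideal (I W) (\<O> W)" by (rule sheaf_ideal[OF I Wo])
      have clW: "ideal (cl W (I W)) (\<O> W)" by (rule cl_ideal[OF W(1) IW])
      interpret r: ring_hom_ring "\<O> V" "\<O> W" "res V W" by (rule res_ring_hom[OF Vo Wo W(3)])
      have "F \<subseteq> {r \<in> carrier (\<O> V). res V W r \<in> cl W (I W)}" using F(1) W(4) by blast
      then have "?J V \<subseteq> {r \<in> carrier (\<O> V). res V W r \<in> cl W (I W)}"
        unfolding F(3) by (rule OV.genideal_minimal[OF r.ideal_vimage[OF clW]])
      then have "res V W ` ?J V \<subseteq> cl W (I W)" by blast
      then have "res V W (res U V s) \<in> cl W (cl W (I W))"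
        by (rule res_cl[OF V(1) W(1,3) sheaf_ideal[OF J Vo] clW _ sV])
      moreover have "cl W (cl W (I W)) = cl W (I W)"
        using cl W(1) IW unfolding ideals_closure_def closure_on_def by blast
      moreover have "res V W (res U V s) = res U W s" by (rule res_res[OF U Vo Wo VU W(3) sc])
      ultimately show "\<exists>V. affine_open X V \<and> x \<in> V \<and> V \<subseteq> U \<and> res U V s \<in> cl V (I V)"
        using W(1-3) VU by (intro exI[of _ W]) auto
    qed
  qed
qed

end

theorem mainTheorem2:
  fixes X :: "('a, 'b) ringed_space"
    and cl :: "'a set \<Rightarrow> 'b set \<Rightarrow> 'b set"
  assumes "is_scheme X"
    and "ideals_preclosure X cl"
    and "openly_persistent X cl"
  shows
    "(\<forall>I. ideal_sheaf X I \<longrightarrow>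
        (\<forall>U s. openin (underlying X) U \<longrightarrow> s \<in> carrier (sections X U) \<longrightarrow>
           (s \<in> sheaf_cl X cl I U \<longleftrightarrow>
             (\<exists>C. (\<forall>V\<in>C. affine_open X V \<and> V \<subseteq> U) \<and> U = \<Union>C \<and>
                (\<forall>V\<in>C. restriction X U V s \<in> cl V (I V)))))) \<and>
     (\<forall>I. ideal_sheaf X I \<longrightarrow> ideal_sheaf X (sheaf_cl X cl I)) \<and>
     preclosure_on {I. ideal_sheaf X I} (subsheaf X) (sheaf_cl X cl) \<and>
     (noetherian_scheme X \<and> ideals_closure X cl \<longrightarrow>
        (\<forall>I U. ideal_sheaf X I \<longrightarrow> openin (underlying X) U \<longrightarrow>
           sheaf_cl X cl (sheaf_cl X cl I) U = sheaf_cl X cl I U))"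
proof -
  interpret scheme_preclosure X cl by (rule scheme_preclosure.intro[OF assms])
  have "preclosure_on {I. ideal_sheaf X I} (subsheaf X) (sheaf_cl X cl)"
    unfolding preclosure_on_def
    using ideal_sheaf_sheaf_cl subset_sheaf_cl sheaf_cl_mono by (auto simp: subsheaf_def)
  then show ?thesis
    using sheaf_cl_iff_cover ideal_sheaf_sheaf_cl sheaf_cl_idem by (intro conjI allI impI) auto
qed

end
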